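(* Let $G_0=\sum_{j=1}^{K_0}\tilde\alpha^0_j\delta_{\theta^0_j}\in\mathcal{E}_{K_0}$ and let $K>K_0$. Then the minimal identifiable document lengths satisfy: 1. (Distinct topics, i.e. no further assumption.) $\mathfrak{N}_e(G_0)\le 2K_0-1$ and $\mathfrak{N}_o(G_0,K)\le 2K_0$. 2. If the topics $\theta^0_1,\dots,\theta^0_{K_0}$ have rank $R$ and Kruskal rank $R_K$, then $\mathfrak{N}_e(G_0)\le\lceil (2K_0-1)/(R_K-1)\rceil$ (for $K_0\ge2$) and $\mathfrak{N}_o(G_0,K)\le K+K_0+3-2R$. 3. If $\theta^0_1,\dots,\theta^0_{K_0}$ are linearly independent, then $\mathfrak{N}_e(G_0)\le 3$ and $\mathfrak{N}_o(G_0,K)\le 4$. 4. If $\theta^0_1,\dots,\theta^0_{K_0}$ satisfy the anchor-word condition, then $\mathfrak{N}_e(G_0)\le 2$ and $\mathfrak{N}_o(G_0,K)\le 2$.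
   Context: $\Delta^{D-1}$ is the set of probability vectors in $\mathbb{R}^D$. $\mathcal{E}_K$ is the set of discrete probability measures on $\Delta^{V-1}$ with exactly $K$ atoms (distinct atoms, positive weights), and $\mathcal{O}_K=\bigcup_{k=1}^K\mathcal{E}_k$. A concentration parameter $\overline{\alpha}>0$ is known and fixed throughout. For $G=\sum_{k=1}^K\tilde\alpha_k\delta_{\theta_k}$ and document length $N$, the LDA probability mass function on $\{1,\dots,V\}^N$ is $$p^{\mathscr{L}}_{G,N}(x)=\mathbb{E}_{q\sim\mathrm{Dir}_{\overline{\alpha}\tilde\alpha}}\prod_{j=1}^N\Big(\sum_{k=1}^Kq_k\theta_{kx_j}\Big).$$ For $G_0\in\mathcal{E}_{K_0}$, $p^{\mathscr{L}}_{G_0,N}$ satisfies exact-fitted identifiability if, for any $G\in\mathcal{O}_{K_0}$, $p^{\mathscr{L}}_{G,N}=p^{\mathscr{L}}_{G_0,N}$ implies $G=G_0$; it satisfies over-fitted identifiability up to order $K$ (with $K>K_0$) if the same implication holds for any $G\in\mathcal{O}_K$. $\mathfrak{N}_e(G_0)$ (resp. $\mathfrak{N}_o(G_0,K)$) is the minimum $N$ such that $p^{\mathscr{L}}_{G_0,N}$ satisfies exact-fitted identifiability (resp. over-fitted identifiability up to order $K$). The rank of the topics is the dimension of their linear span; their Kruskal rank $R_K$ is the largest number $r$ such that every subset of $r$ vectors in $\{\theta_1^0,\dots,\theta_{K_0}^0\}$ is linearly independent. The anchor-word condition: for every $k\in\{1,\dots,K_0\}$ there is $v=v(k)\in\{1,\dots,V\}$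 with $\theta^0_{kv}>0$ and $\theta^0_{k'v}=0$ for all $k'\ne k$. *)

theory Defs
  imports "HOL-Probability.Probability"
begin

section \<open>Mixing measures on the simplex\<close>

text \<open>The vocabulary is a finite type \<open>'v\<close>, so that \<open>V = CARD('v)\<close> and topics are vectors in
  \<open>real ^ 'v\<close>. A discrete probability measure is a \<open>pmf\<close>: its atoms are \<open>set_pmf G\<close>
  (automatically distinct and of positive weight) and the weight of \<open>\<theta>\<close> is \<open>pmf G \<theta>\<close>.\<close>

definition prob_simplex :: "(real ^ 'v) set" where
  "prob_simplex = {\<theta>. (\<forall>v. 0 \<le> \<theta> $ v) \<and> (\<Sum>v\<in>UNIV. \<theta> $ v) = 1}"

definition mixing_exact :: "nat \<Rightarrow> (real ^ 'v) pmf set" where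
  "mixing_exact K = {G. set_pmf G \<subseteq> prob_simplex \<and> finite (set_pmf G) \<and> card (set_pmf G) = K}"

definition mixing_upto :: "nat \<Rightarrow> (real ^ 'v) pmf set" where
  "mixing_upto K = (\<Union>k\<in>{1..K}. mixing_exact k)"

section \<open>The Dirichlet distribution\<close>

text \<open>The Dirichlet distribution on the probability vectors indexed by a finite set \<open>I\<close> has the
  usual density with respect to Lebesgue measure in all coordinates but one. The dropped
  coordinate \<open>r\<close> is recovered as one minus the sum of the others; the resulting measure does not
  depend on \<open>r\<close>. If \<open>I = {r}\<close>, it is the point mass at the only probability vector.\<close>

definition dirichlet_density :: "'i set \<Rightarrow> ('i \<Rightarrow> real) \<Rightarrow> ('i \<Rightarrow> real) \<Rightarrow> real" where
  "dirichlet_density I \<alpha> q =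
     (if \<forall>i\<in>I. 0 < q i
      then Gamma (\<Sum>i\<in>I. \<alpha> i) / (\<Prod>i\<in>I. Gamma (\<alpha> i)) * (\<Prod>i\<in>I. q i powr (\<alpha> i - 1))
      else 0)"

definition complete_coord :: "'i set \<Rightarrow> 'i \<Rightarrow> ('i \<Rightarrow> real) \<Rightarrow> ('i \<Rightarrow> real)" where
  "complete_coord I r y = (\<lambda>i\<in>I. if i = r then 1 - (\<Sum>j\<in>I - {r}. y j) else y i)"

definition dirichlet_wrt :: "'i \<Rightarrow> 'i set \<Rightarrow> ('i \<Rightarrow> real) \<Rightarrow> ('i \<Rightarrow> real) measure" where
  "dirichlet_wrt r I \<alpha> =
     distr (density (\<Pi>\<^sub>M i\<in>I - {r}. lborel)
              (\<lambda>y. ennreal (dirichlet_density I \<alpha> (complete_coord I r y))))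
           (\<Pi>\<^sub>M i\<in>I. borel) (complete_coord I r)"

definition dirichlet :: "'i set \<Rightarrow> ('i \<Rightarrow> real) \<Rightarrow> ('i \<Rightarrow> real) measure" where
  "dirichlet I \<alpha> = dirichlet_wrt (SOME r. r \<in> I) I \<alpha>"

section \<open>The LDA model and identifiability\<close>

text \<open>The Dirichlet proportions are indexed by the atoms of \<open>G\<close> themselves, which avoids a
  labelling of the atoms. A document is an extensional function on \<open>{1..N}\<close>, and the mass function
  is restricted to documents, so that equality of mass functions is equality on \<open>{1, \<dots>, V}^N\<close>.\<close>

definition lda_pmf :: "real \<Rightarrow> (real ^ 'v) pmf \<Rightarrow> nat \<Rightarrow> (nat \<Rightarrow> 'v) \<Rightarrow> real" where
  "lda_pmf a G N =
     (\<lambda>x \<in> ({1..N} \<rightarrow>\<^sub>E UNIV).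
        \<integral>q. (\<Prod>j=1..N. \<Sum>\<theta>\<in>set_pmf G. q \<theta> * \<theta> $ x j)
          \<partial>dirichlet (set_pmf G) (\<lambda>\<theta>. a * pmf G \<theta>))"

definition identifiable_upto :: "real \<Rightarrow> nat \<Rightarrow> (real ^ 'v) pmf \<Rightarrow> nat \<Rightarrow> bool" where
  "identifiable_upto a K G0 N \<longleftrightarrow>
     (\<forall>G\<in>mixing_upto K. lda_pmf a G N = lda_pmf a G0 N \<longrightarrow> G = G0)"

text \<open>The minimal lengths range over positive document lengths and live in \<open>enat\<close>: if no length is
  identifiable the value is \<open>\<infinity>\<close>, so a finite bound asserts that an identifiable length exists.\<close>

definition min_len_exact :: "real \<Rightarrow> (real ^ 'v) pmf \<Rightarrow> enat" where
  "min_len_exact a G0 =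
     (INF N\<in>{N. 1 \<le> N \<and> identifiable_upto a (card (set_pmf G0)) G0 N}. enat N)"

definition min_len_over :: "real \<Rightarrow> (real ^ 'v) pmf \<Rightarrow> nat \<Rightarrow> enat" where
  "min_len_over a G0 K = (INF N\<in>{N. 1 \<le> N \<and> identifiable_upto a K G0 N}. enat N)"

section \<open>Conditions on the topics\<close>

text \<open>Without \<open>r \<le> card S\<close> the condition would hold vacuously for all large \<open>r\<close>.\<close>

definition kruskal_rank :: "(real ^ 'v) set \<Rightarrow> nat" where
  "kruskal_rank S = Max {r. r \<le> card S \<and> (\<forall>T\<subseteq>S. card T = r \<longrightarrow> independent T)}"

definition anchor_word :: "(real ^ 'v) set \<Rightarrow> bool" where
  "anchor_word S \<longleftrightarrow> (\<forall>\<theta>\<in>S. \<exists>v. 0 < \<theta> $ v \<and> (\<forall>\<theta>'\<in>S - {\<theta>}. \<theta>' $ v = 0))"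

end

theory Submission imports Defs begin

text \<open>
  The heart of the matter is that a document of length \<open>N\<close> carries the same information as \<open>N\<close>
  words drawn independently from a topic that is itself drawn from the mixing measure. If \<open>q\<close> is
  Dirichlet with parameters \<open>\<alpha>\<close>, of total mass \<open>a\<close>, then the moments of the random linear
  functional \<open>\<Sum>i. q i * s i\<close> satisfy
  \<open>\<Sum>n. (pochhammer a n / n!) * E[(\<Sum>i. q i * s i)^n] * z^n = \<Prod>i. (1 - s i * z) powr (- \<alpha> i)\<close>.
  The logarithmic derivative of the right-hand side generates the power sums
  \<open>\<Sum>i. \<alpha> i * (s i)^n\<close>, so the Dirichlet moments up to order \<open>N\<close> and the power sums up to order
  \<open>N\<close> determine each other (\<open>dirichlet_moment\<close>, \<open>dirichlet_coeff_newton\<close>). With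
  \<open>s \<theta> = \<theta> \<bullet> t\<close> and \<open>\<alpha> \<theta> = a * pmf G \<theta>\<close> this says that the LDA mass function of length \<open>N\<close>
  determines the expectation under \<open>G\<close> of every power of degree at most \<open>N\<close> of a linear functional,
  hence, by polarization, of every product of at most \<open>N\<close> linear functionals.

  What remains is a question about finite point configurations: when do two mixing measures that give the
  same expectation to all forms of degree at most \<open>N\<close> coincide? Two principles answer it.
  A form that vanishes on all atoms of both measures except one shows that the two weights of that
  atom agree (\<open>pmf_eq_if_isolated\<close>). A form that is nonnegative on the atoms of \<open>G\<close> and
  vanishes on those of \<open>G0\<close> vanishes on those of \<open>G\<close> as well (\<open>nonneg_form_vanishes\<close>); this is what
  makes a bound possible that does not depend on the number of atoms of \<open>G\<close>.

  For distinct topics, one linear form for each atom to be avoided gives the bounds \<open>2 * K0 - 1\<close> (isolate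
  every atom) and \<open>2 * K0\<close> (square a form that vanishes on the atoms of \<open>G0\<close>). Squares of linear forms
  confine the atoms of \<open>G\<close> to the span of the topics. For independent topics with dual
  functionals \<open>u\<close>, the squares of the products \<open>(u x \<bullet> y) * (u z \<bullet> y)\<close> then leave no further point
  than the topics; for anchor words these products are nonnegative themselves, which lowers the degree
  from 4 to 2. For topics of rank \<open>R\<close>, both sets of atoms span the same space of dimension \<open>R\<close>,
  so two linear forms avoid \<open>R - 1\<close> atoms of either measure at once.

  The bound by the Kruskal rank is a symmetric instance of Kruskal's uniqueness theorem for tensor
  decompositions. As the atoms of \<open>G\<close> satisfy no condition of general position, they cannot be isolated
  directly. Instead \<open>hyperplane_inequality\<close> compares the numbers of atoms of the two measures outside a
  hyperplane, and \<open>flat_inequality\<close> carries the comparison down from hyperplanes to lines, where it says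
  that each atom of \<open>G\<close> is a topic.
\<close>

section \<open>Moments of the Dirichlet distribution\<close>

lemma nn_integral_beta_scaled:
  fixes a b s :: real
  assumes "a > 0" "b > 0" "s > 0"
  shows "(\<integral>\<^sup>+x. ennreal (if 0 < x \<and> x < s then x powr (a - 1) * (s - x) powr (b - 1) else 0) \<partial>lborel)
         = ennreal (Beta a b * s powr (a + b - 1))"
proof -
  let ?g = "\<lambda>t. t powr (a - 1) * (1 - t) powr (b - 1)"
  let ?h = "\<lambda>x. ennreal (if 0 < x \<and> x < s then x powr (a - 1) * (s - x) powr (b - 1) else 0)"
  have unit: "(\<integral>\<^sup>+t. ennreal (?g t) * indicator {0<..<1} t \<partial>lborel) = ennreal (Beta a b)"
    using has_integral_Beta_real[OF assms(1,2)]
    by (intro nn_integral_has_integral_lebesgue') (auto simp: has_integral_Icc_iff_Ioo)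
  have scaled: "?h (0 + s * t) = ennreal (s powr (a + b - 2)) * (ennreal (?g t) * indicator {0<..<1} t)" for t
  proof (cases "0 < t \<and> t < 1")
    case True
    then have "(s * t) powr (a - 1) * (s - s * t) powr (b - 1) = s powr (a + b - 2) * ?g t"
      using assms powr_mult[of s t "a - 1"] powr_mult[of s "1 - t" "b - 1"]
        powr_add[of s "a - 1" "b - 1"]
      by (simp add: algebra_simps)
    then show ?thesis
      using True assms by (simp add: ennreal_mult')
  next
    case False
    then show ?thesis
      using assms by (auto simp: zero_less_mult_iff)
  qed
  have Beta: "0 \<le> Beta a b"
    using assms by (simp add: Beta_def Gamma_real_pos less_imp_le)
  have "(\<integral>\<^sup>+x. ?h x \<partial>lborel) = ennreal \<bar>s\<bar> * (\<integral>\<^sup>+t. ?h (0 + s * t) \<partial>lborel)"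
    using assms by (intro nn_integral_real_affine) auto
  also have "\<dots> = ennreal s * (ennreal (s powr (a + b - 2)) * ennreal (Beta a b))"
    unfolding scaled using assms by (subst nn_integral_cmult) (simp_all add: unit)
  also have "\<dots> = ennreal (Beta a b * s powr (a + b - 1))"
    using assms powr_add[of s 1 "a + b - 2"] Beta
    by (simp add: ennreal_mult'[symmetric] mult_ac)
  finally show ?thesis .
qed

text \<open>Integrating out one coordinate \<open>x\<close> leaves the same integral over a simplex of size \<open>s - x\<close>, which by
  homogeneity is a power of \<open>s - x\<close>; the remaining integral over \<open>x\<close> is a Beta integral. The size \<open>s\<close>
  is kept variable for the sake of this induction.\<close>

lemma liouville_dirichlet:
  fixes \<alpha> :: "'i \<Rightarrow> real" and \<beta> s :: real
  assumes "finite J" "\<And>j. j \<in> J \<Longrightarrow> \<alpha> j > 0" "\<beta> > 0" "s > 0"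
  shows "(\<integral>\<^sup>+y. ennreal (if (\<forall>j\<in>J. 0 < y j) \<and> (\<Sum>j\<in>J. y j) < s
              then (\<Prod>j\<in>J. y j powr (\<alpha> j - 1)) * (s - (\<Sum>j\<in>J. y j)) powr (\<beta> - 1) else 0)
            \<partial>(\<Pi>\<^sub>M j\<in>J. lborel))
         = ennreal ((\<Prod>j\<in>J. Gamma (\<alpha> j)) * Gamma \<beta> / Gamma ((\<Sum>j\<in>J. \<alpha> j) + \<beta>)
                    * s powr ((\<Sum>j\<in>J. \<alpha> j) + \<beta> - 1))"
  using assms(1,2,4)
proof (induction J arbitrary: s rule: finite_induct)
  case empty
  interpret product_sigma_finite "\<lambda>_::'i. lborel :: real measure"
    by (simp add: product_sigma_finite_def lborel.sigma_finite_measure_axioms)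
  show ?case
    using empty Gamma_real_pos[OF assms(3)]
    by (simp add: PiM_empty emeasure_count_space nn_integral_count_space_finite)
next
  case (insert i J)
  interpret product_sigma_finite "\<lambda>_::'i. lborel :: real measure"
    by (simp add: product_sigma_finite_def lborel.sigma_finite_measure_axioms)
  let ?\<gamma> = "(\<Sum>j\<in>J. \<alpha> j) + \<beta>"
  let ?C = "(\<Prod>j\<in>J. Gamma (\<alpha> j)) * Gamma \<beta> / Gamma ?\<gamma>"
  let ?f = "\<lambda>J s y. ennreal (if (\<forall>j\<in>J. 0 < y j) \<and> (\<Sum>j\<in>J. y j) < s
              then (\<Prod>j\<in>J. y j powr (\<alpha> j - 1)) * (s - (\<Sum>j\<in>J. y j)) powr (\<beta> - 1) else 0)"
  have \<gamma>: "?\<gamma> > 0"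
    using insert.prems assms(3) by (simp add: add_nonneg_pos sum_nonneg less_imp_le)
  have C: "?C \<ge> 0"
    using insert.prems assms(3) \<gamma> by (auto intro!: divide_nonneg_pos mult_nonneg_nonneg prod_nonneg simp: less_imp_le)
  have inner: "(\<integral>\<^sup>+y. ?f (insert i J) s (y(i := x)) \<partial>(\<Pi>\<^sub>M j\<in>J. lborel))
      = ennreal ?C * ennreal (if 0 < x \<and> x < s then x powr (\<alpha> i - 1) * (s - x) powr (?\<gamma> - 1) else 0)" for x
  proof (cases "0 < x \<and> x < s")
    case True
    have "?f (insert i J) s (y(i := x)) = ennreal (x powr (\<alpha> i - 1)) * ?f J (s - x) y" for y
    proof -
      have "(\<Sum>j\<in>J. (y(i := x)) j) = (\<Sum>j\<in>J. y j)"
        using insert.hyps by (intro sum.cong) auto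
      moreover have "(\<Prod>j\<in>J. (y(i := x)) j powr (\<alpha> j - 1)) = (\<Prod>j\<in>J. y j powr (\<alpha> j - 1))"
        using insert.hyps by (intro prod.cong) auto
      moreover have "(\<forall>j\<in>insert i J. 0 < (y(i := x)) j) \<longleftrightarrow> (\<forall>j\<in>J. 0 < y j)"
        using insert.hyps True by auto
      ultimately show ?thesis
        using insert.hyps
        by (auto simp: ennreal_mult'[symmetric] algebra_simps simp del: fun_upd_apply)
           (auto simp: algebra_simps)
    qed
    then have "(\<integral>\<^sup>+y. ?f (insert i J) s (y(i := x)) \<partial>(\<Pi>\<^sub>M j\<in>J. lborel))
       = ennreal (x powr (\<alpha> i - 1)) * (\<integral>\<^sup>+y. ?f J (s - x) y \<partial>(\<Pi>\<^sub>M j\<in>J. lborel))"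
      using insert.hyps by (simp only:) (subst nn_integral_cmult, measurable)
    also have "\<dots> = ennreal (x powr (\<alpha> i - 1)) * ennreal (?C * (s - x) powr (?\<gamma> - 1))"
      using insert.prems True by (subst insert.IH) auto
    finally show ?thesis
      using True C by (simp add: ennreal_mult'[symmetric] mult_ac)
  next
    case False
    have "?f (insert i J) s (y(i := x)) = 0" for y
    proof -
      have "\<not> ((\<forall>j\<in>insert i J. 0 < (y(i := x)) j) \<and> (\<Sum>j\<in>insert i J. (y(i := x)) j) < s)"
      proof
        assume *: "(\<forall>j\<in>insert i J. 0 < (y(i := x)) j) \<and> (\<Sum>j\<in>insert i J. (y(i := x)) j) < s"
        then have "0 \<le> (\<Sum>j\<in>J. (y(i := x)) j)"
          by (intro sum_nonneg) (auto simp: less_imp_le)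
        with * False insert.hyps show False by auto
      qed
      then show ?thesis by (simp only: if_False) simp
    qed
    then show ?thesis using False by (simp only: nn_integral_const) simp
  qed
  have "(\<integral>\<^sup>+y. ?f (insert i J) s y \<partial>(\<Pi>\<^sub>M j\<in>insert i J. lborel))
      = (\<integral>\<^sup>+x. (\<integral>\<^sup>+y. ?f (insert i J) s (y(i := x)) \<partial>(\<Pi>\<^sub>M j\<in>J. lborel)) \<partial>lborel)"
    using insert.hyps by (intro product_nn_integral_insert_rev) auto
  also have "\<dots> = ennreal ?C * ennreal (Beta (\<alpha> i) ?\<gamma> * s powr (\<alpha> i + ?\<gamma> - 1))"
    unfolding inner using insert.prems \<gamma>
    by (subst nn_integral_cmult) (simp_all add: nn_integral_beta_scaled)
  also have "\<dots> = ennreal ((\<Prod>j\<in>insert i J. Gamma (\<alpha> j)) * Gamma \<beta> / Gamma ((\<Sum>j\<in>insert i J. \<alpha> j) + \<beta>)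
                    * s powr ((\<Sum>j\<in>insert i J. \<alpha> j) + \<beta> - 1))"
    using insert.hyps C Gamma_real_pos[OF \<gamma>]
    by (simp add: ennreal_mult'[symmetric] Beta_def add_ac mult_ac)
  finally show ?case .
qed

lemma measurable_complete_coord [measurable]:
  assumes "finite I"
  shows "complete_coord I r \<in> measurable (\<Pi>\<^sub>M i\<in>I - {r}. lborel) (\<Pi>\<^sub>M i\<in>I. borel)"
  unfolding complete_coord_def
proof (rule measurable_restrict)
  fix i assume "i \<in> I"
  then show "(\<lambda>y. if i = r then 1 - (\<Sum>j\<in>I - {r}. y j) else y i)
      \<in> borel_measurable (\<Pi>\<^sub>M i\<in>I - {r}. lborel)"
    by (cases "i = r") (simp_all, measurable)
qed

lemma measurable_dirichlet_density [measurable]: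
  assumes "finite I"
  shows "dirichlet_density I \<alpha> \<in> borel_measurable (\<Pi>\<^sub>M i\<in>I. borel)"
  unfolding dirichlet_density_def using assms by measurable

lemma dirichlet_density_nonneg:
  assumes "\<And>i. i \<in> I \<Longrightarrow> \<alpha> i > 0"
  shows "0 \<le> dirichlet_density I \<alpha> q"
proof -
  have "(\<Sum>i\<in>I. \<alpha> i) \<ge> 0"
    using assms by (intro sum_nonneg) (auto simp: less_imp_le)
  then have "Gamma (\<Sum>i\<in>I. \<alpha> i) \<ge> 0"
    by (cases "(\<Sum>i\<in>I. \<alpha> i) = 0") auto
  then show ?thesis
    unfolding dirichlet_density_def using assms
    by (auto intro!: mult_nonneg_nonneg divide_nonneg_nonneg prod_nonneg simp: less_imp_le)
qed

lemma sum_complete_coord: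
  assumes "finite I" "r \<in> I"
  shows "(\<Sum>i\<in>I. complete_coord I r y i) = 1"
proof -
  have "(\<Sum>i\<in>I. complete_coord I r y i) = complete_coord I r y r + (\<Sum>i\<in>I - {r}. complete_coord I r y i)"
    using assms by (rule sum.remove)
  also have "(\<Sum>i\<in>I - {r}. complete_coord I r y i) = (\<Sum>i\<in>I - {r}. y i)"
    by (intro sum.cong) (auto simp: complete_coord_def)
  finally show ?thesis using assms by (simp add: complete_coord_def)
qed

lemma nn_integral_dirichlet_density:
  assumes "finite I" "r \<in> I" "\<And>i. i \<in> I \<Longrightarrow> \<alpha> i > 0"
  shows "(\<integral>\<^sup>+y. ennreal (dirichlet_density I \<alpha> (complete_coord I r y)) \<partial>(\<Pi>\<^sub>M i\<in>I - {r}. lborel)) = 1"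
proof -
  let ?J = "I - {r}"
  let ?c = "Gamma (\<Sum>i\<in>I. \<alpha> i) / (\<Prod>i\<in>I. Gamma (\<alpha> i))"
  let ?k = "\<lambda>y. if (\<forall>j\<in>?J. 0 < y j) \<and> (\<Sum>j\<in>?J. y j) < 1
              then (\<Prod>j\<in>?J. y j powr (\<alpha> j - 1)) * (1 - (\<Sum>j\<in>?J. y j)) powr (\<alpha> r - 1) else 0"
  have pos: "(\<Sum>i\<in>I. \<alpha> i) > 0"
    using assms by (intro sum_pos) auto
  have c: "?c \<ge> 0"
    using assms pos by (auto intro!: divide_nonneg_nonneg prod_nonneg simp: less_imp_le)
  have dens: "dirichlet_density I \<alpha> (complete_coord I r y) = ?c * ?k y" for y
  proof -
    have ins: "I = insert r ?J" using assms by auto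
    have "(\<Prod>i\<in>?J. complete_coord I r y i powr (\<alpha> i - 1)) = (\<Prod>i\<in>?J. y i powr (\<alpha> i - 1))"
      by (intro prod.cong) (auto simp: complete_coord_def)
    moreover have "(\<Prod>i\<in>I. complete_coord I r y i powr (\<alpha> i - 1))
        = complete_coord I r y r powr (\<alpha> r - 1) * (\<Prod>i\<in>?J. complete_coord I r y i powr (\<alpha> i - 1))"
      using assms by (intro prod.remove) auto
    moreover have "(\<forall>i\<in>I. 0 < complete_coord I r y i) \<longleftrightarrow> (\<forall>j\<in>?J. 0 < y j) \<and> (\<Sum>j\<in>?J. y j) < 1"
      using assms(2) by (auto simp: complete_coord_def)
    moreover have "complete_coord I r y r = 1 - (\<Sum>j\<in>?J. y j)"
      using assms(2) by (simp add: complete_coord_def)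
    ultimately show ?thesis
      by (simp add: dirichlet_density_def mult_ac)
  qed
  have "(\<integral>\<^sup>+y. ennreal (dirichlet_density I \<alpha> (complete_coord I r y)) \<partial>(\<Pi>\<^sub>M i\<in>?J. lborel))
      = ennreal ?c * (\<integral>\<^sup>+y. ennreal (?k y) \<partial>(\<Pi>\<^sub>M i\<in>?J. lborel))"
    unfolding dens ennreal_mult'[OF c] using assms by (intro nn_integral_cmult) measurable
  also have "\<dots> = ennreal ?c * ennreal ((\<Prod>j\<in>?J. Gamma (\<alpha> j)) * Gamma (\<alpha> r) / Gamma ((\<Sum>j\<in>?J. \<alpha> j) + \<alpha> r))"
    using assms by (subst liouville_dirichlet) auto
  also have "\<dots> = 1"
  proof -
    have "(\<Prod>j\<in>?J. Gamma (\<alpha> j)) * Gamma (\<alpha> r) = (\<Prod>i\<in>I. Gamma (\<alpha> i))"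
      using prod.remove[OF assms(1,2), of "\<lambda>i. Gamma (\<alpha> i)"] by (simp add: mult_ac)
    moreover have "(\<Sum>j\<in>?J. \<alpha> j) + \<alpha> r = (\<Sum>i\<in>I. \<alpha> i)"
      using sum.remove[OF assms(1,2), of \<alpha>] by simp
    moreover have "(\<Prod>i\<in>I. Gamma (\<alpha> i)) > 0"
      using assms by (intro prod_pos) (auto simp: Gamma_real_pos)
    ultimately show ?thesis
      using c Gamma_real_pos[OF pos] by (simp add: ennreal_mult'[symmetric])
  qed
  finally show ?thesis .
qed

lemma sets_dirichlet [measurable_cong, simp]: "sets (dirichlet I \<alpha>) = sets (\<Pi>\<^sub>M i\<in>I. borel)"
  by (simp add: dirichlet_def dirichlet_wrt_def)

context
  fixes I :: "'i set" and \<alpha> :: "'i \<Rightarrow> real"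
  assumes fin: "finite I" and ne: "I \<noteq> {}" and pos: "\<And>i. i \<in> I \<Longrightarrow> \<alpha> i > 0"
begin

lemma prob_space_dirichlet: "prob_space (dirichlet I \<alpha>)"
proof
  let ?r = "SOME r. r \<in> I"
  have [measurable]: "complete_coord I ?r \<in> measurable (\<Pi>\<^sub>M i\<in>I - {?r}. lborel) (\<Pi>\<^sub>M i\<in>I. borel)"
    "dirichlet_density I \<alpha> \<in> borel_measurable (\<Pi>\<^sub>M i\<in>I. borel)"
    using fin by measurable
  have "emeasure (dirichlet I \<alpha>) (space (dirichlet I \<alpha>))
      = (\<integral>\<^sup>+y. ennreal (dirichlet_density I \<alpha> (complete_coord I ?r y)) \<partial>(\<Pi>\<^sub>M i\<in>I - {?r}. lborel))"
    unfolding dirichlet_def dirichlet_wrt_def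
    by (simp add: emeasure_distr emeasure_density cong: nn_integral_cong)
       (auto intro!: nn_integral_cong simp: indicator_def dest: measurable_space[OF \<open>complete_coord I ?r \<in> _\<close>])
  then show "emeasure (dirichlet I \<alpha>) (space (dirichlet I \<alpha>)) = 1"
    using nn_integral_dirichlet_density[of I ?r \<alpha>] fin pos some_in_eq[THEN iffD2, OF ne] by simp
qed

lemma AE_dirichlet: "AE q in dirichlet I \<alpha>. (\<forall>i\<in>I. 0 < q i) \<and> (\<Sum>i\<in>I. q i) = 1"
proof -
  let ?r = "SOME r. r \<in> I"
  have [measurable]: "complete_coord I ?r \<in> measurable (\<Pi>\<^sub>M i\<in>I - {?r}. lborel) (\<Pi>\<^sub>M i\<in>I. borel)"
    "dirichlet_density I \<alpha> \<in> borel_measurable (\<Pi>\<^sub>M i\<in>I. borel)"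
    using fin by measurable
  have [measurable]: "{q \<in> space (\<Pi>\<^sub>M i\<in>I. borel). (\<forall>i\<in>I. 0 < q i) \<and> (\<Sum>i\<in>I. q i) = (1::real)}
      \<in> sets (\<Pi>\<^sub>M i\<in>I. borel)"
    using fin by measurable
  show ?thesis
    unfolding dirichlet_def dirichlet_wrt_def
    by (subst AE_distr_iff, measurable, subst AE_density, measurable)
       (auto simp: dirichlet_density_def sum_complete_coord[OF fin some_in_eq[THEN iffD2, OF ne]])
qed

lemma integral_dirichlet:
  fixes f :: "('i \<Rightarrow> real) \<Rightarrow> real"
  assumes [measurable]: "f \<in> borel_measurable (\<Pi>\<^sub>M i\<in>I. borel)"
  defines "r \<equiv> SOME r. r \<in> I"
  shows "(\<integral>q. f q \<partial>dirichlet I \<alpha>) =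
    (\<integral>y. dirichlet_density I \<alpha> (complete_coord I r y) * f (complete_coord I r y) \<partial>(\<Pi>\<^sub>M i\<in>I - {r}. lborel))"
proof -
  have [measurable]: "complete_coord I r \<in> measurable (\<Pi>\<^sub>M i\<in>I - {r}. lborel) (\<Pi>\<^sub>M i\<in>I. borel)"
    "dirichlet_density I \<alpha> \<in> borel_measurable (\<Pi>\<^sub>M i\<in>I. borel)"
    using fin by measurable
  show ?thesis
    unfolding dirichlet_def dirichlet_wrt_def r_def[symmetric]
    by (subst integral_distr, measurable) (subst integral_density, auto simp: dirichlet_density_nonneg pos)
qed

end

text \<open>A factor \<open>q k\<close> raises the exponent of \<open>q k\<close> by one, and \<open>\<Gamma>(x + 1) = x * \<Gamma>(x)\<close>
  accounts for the change of the normalizing constant.\<close>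

lemma dirichlet_density_shift:
  assumes "finite I" "k \<in> I" "\<And>i. i \<in> I \<Longrightarrow> \<alpha> i > 0"
  shows "dirichlet_density I \<alpha> q * q k
       = \<alpha> k / (\<Sum>i\<in>I. \<alpha> i) * dirichlet_density I (\<alpha>(k := \<alpha> k + 1)) q"
proof (cases "\<forall>i\<in>I. 0 < q i")
  case True
  let ?\<alpha>' = "\<alpha>(k := \<alpha> k + 1)"
  have pos: "(\<Sum>i\<in>I. \<alpha> i) > 0"
    using assms by (intro sum_pos) auto
  have sum: "(\<Sum>i\<in>I. ?\<alpha>' i) = (\<Sum>i\<in>I. \<alpha> i) + 1"
    using assms by (simp add: sum.remove[of I k])
  have Gamma_shift: "Gamma (x + 1) = x * Gamma x" if "x > 0" for x :: real
    using that by (intro Gamma_plus1) (auto elim!: nonpos_Ints_cases)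
  have Gam: "(\<Prod>i\<in>I. Gamma (?\<alpha>' i)) = \<alpha> k * (\<Prod>i\<in>I. Gamma (\<alpha> i))"
    using assms assms(3)[of k] by (simp add: prod.remove[of I k] Gamma_shift)
  have pow: "(\<Prod>i\<in>I. q i powr (?\<alpha>' i - 1)) = q k * (\<Prod>i\<in>I. q i powr (\<alpha> i - 1))"
    using assms True powr_add[of "q k" "\<alpha> k - 1" 1] bspec[OF True assms(2)]
    by (simp add: prod.remove[of I k])
  show ?thesis
    using True pos Gamma_shift[OF pos] assms(3)[OF assms(2)] unfolding dirichlet_density_def sum Gam pow by simp
qed (use assms in \<open>auto simp: dirichlet_density_def\<close>)

lemma integral_dirichlet_shift:
  fixes f :: "('i \<Rightarrow> real) \<Rightarrow> real"
  assumes "finite I" "k \<in> I" "\<And>i. i \<in> I \<Longrightarrow> \<alpha> i > 0"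
    and [measurable]: "f \<in> borel_measurable (\<Pi>\<^sub>M i\<in>I. borel)"
  shows "(\<integral>q. q k * f q \<partial>dirichlet I \<alpha>)
       = \<alpha> k / (\<Sum>i\<in>I. \<alpha> i) * (\<integral>q. f q \<partial>dirichlet I (\<alpha>(k := \<alpha> k + 1)))"
proof -
  let ?r = "SOME r. r \<in> I"
  have ne: "I \<noteq> {}" using assms by auto
  have pos': "i \<in> I \<Longrightarrow> (\<alpha>(k := \<alpha> k + 1)) i > 0" for i
    using assms(3)[of i] by (auto simp: add_pos_pos)
  have [measurable]: "(\<lambda>q. q k * f q) \<in> borel_measurable (\<Pi>\<^sub>M i\<in>I. borel)"
    using assms(2) by measurable
  have "dirichlet_density I \<alpha> q * (q k * f q)
      = \<alpha> k / (\<Sum>i\<in>I. \<alpha> i) * (dirichlet_density I (\<alpha>(k := \<alpha> k + 1)) q * f q)" for q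
    using dirichlet_density_shift[of I k \<alpha> q] assms(1-3) by (simp add: mult.assoc[symmetric])
  then have "(\<integral>q. q k * f q \<partial>dirichlet I \<alpha>)
     = (\<integral>y. \<alpha> k / (\<Sum>i\<in>I. \<alpha> i) * (dirichlet_density I (\<alpha>(k := \<alpha> k + 1)) (complete_coord I ?r y)
           * f (complete_coord I ?r y)) \<partial>(\<Pi>\<^sub>M i\<in>I - {?r}. lborel))"
    using assms(1,3) ne by (subst integral_dirichlet) (auto simp only:, measurable)
  also have "\<dots> = \<alpha> k / (\<Sum>i\<in>I. \<alpha> i) * (\<integral>q. f q \<partial>dirichlet I (\<alpha>(k := \<alpha> k + 1)))"
    using assms(1,4) ne pos' by (subst integral_dirichlet[where \<alpha> = "\<alpha>(k := \<alpha> k + 1)"]) auto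
  finally show ?thesis .
qed

text \<open>The coefficient of \<open>z^n\<close> in \<open>\<Prod>i\<in>I. (1 - s i * z) powr (- \<alpha> i)\<close>. Differentiation in \<open>z\<close> yields
  \<open>\<Sum>i. \<alpha> i * s i\<close> times the same product with \<open>\<alpha> i\<close> increased by one, which is the recursion below. It is
  also the recursion that \<open>integral_dirichlet_shift\<close> gives for the Dirichlet moments.\<close>

primrec dirichlet_coeff :: "'i set \<Rightarrow> ('i \<Rightarrow> real) \<Rightarrow> ('i \<Rightarrow> real) \<Rightarrow> nat \<Rightarrow> real" where
  "dirichlet_coeff I s \<alpha> 0 = 1"
| "dirichlet_coeff I s \<alpha> (Suc n) = (\<Sum>i\<in>I. \<alpha> i * s i * dirichlet_coeff I s (\<alpha>(i := \<alpha> i + 1)) n) / real (Suc n)"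

lemma sum_increment:
  fixes g :: "'i \<Rightarrow> real"
  assumes "finite I" "k \<in> I"
  shows "(\<Sum>i\<in>I. (\<alpha>(k := \<alpha> k + 1)) i * g i) = (\<Sum>i\<in>I. \<alpha> i * g i) + g k"
proof -
  have "(\<Sum>i\<in>I. (\<alpha>(k := \<alpha> k + 1)) i * g i) = (\<Sum>i\<in>I. \<alpha> i * g i + (if i = k then g i else 0))"
    by (intro sum.cong) (auto simp: algebra_simps)
  then show ?thesis
    using assms by (simp add: sum.distrib sum.delta)
qed

text \<open>In terms of generating functions: increasing \<open>\<alpha> k\<close> by one divides the product by \<open>1 - s k * z\<close>.\<close>

lemma dirichlet_coeff_increment:
  assumes "finite I" "k \<in> I"
  shows "dirichlet_coeff I s (\<alpha>(k := \<alpha> k + 1)) (Suc n)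
       = dirichlet_coeff I s \<alpha> (Suc n) + s k * dirichlet_coeff I s (\<alpha>(k := \<alpha> k + 1)) n"
  using assms(2)
proof (induction n arbitrary: \<alpha> k)
  case 0
  then show ?case
    using sum_increment[OF assms(1) 0, of \<alpha> s] by simp
next
  case (Suc n)
  define \<beta> where "\<beta> = \<alpha>(k := \<alpha> k + 1)"
  have comm: "\<beta>(i := \<beta> i + 1) = (\<alpha>(i := \<alpha> i + 1))(k := (\<alpha>(i := \<alpha> i + 1)) k + 1)" for i
    by (auto simp: \<beta>_def fun_eq_iff)
  have IH: "dirichlet_coeff I s (\<beta>(i := \<beta> i + 1)) (Suc n)
      = dirichlet_coeff I s (\<alpha>(i := \<alpha> i + 1)) (Suc n) + s k * dirichlet_coeff I s (\<beta>(i := \<beta> i + 1)) n" for i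
    unfolding comm by (rule Suc.IH[OF Suc.prems])
  have "real (Suc (Suc n)) * dirichlet_coeff I s \<beta> (Suc (Suc n))
      = (\<Sum>i\<in>I. \<beta> i * (s i * dirichlet_coeff I s (\<beta>(i := \<beta> i + 1)) (Suc n)))"
    by (simp add: mult.assoc del: dirichlet_coeff.simps(2)) (simp add: dirichlet_coeff.simps(2)[of I s \<beta> "Suc n"] mult.assoc del: dirichlet_coeff.simps(2))
  also have "\<dots> = (\<Sum>i\<in>I. \<beta> i * (s i * dirichlet_coeff I s (\<alpha>(i := \<alpha> i + 1)) (Suc n)))
      + s k * (\<Sum>i\<in>I. \<beta> i * s i * dirichlet_coeff I s (\<beta>(i := \<beta> i + 1)) n)"
    unfolding IH by (simp add: algebra_simps sum.distrib sum_distrib_left del: dirichlet_coeff.simps)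
  also have "(\<Sum>i\<in>I. \<beta> i * (s i * dirichlet_coeff I s (\<alpha>(i := \<alpha> i + 1)) (Suc n)))
      = (\<Sum>i\<in>I. \<alpha> i * (s i * dirichlet_coeff I s (\<alpha>(i := \<alpha> i + 1)) (Suc n))) + s k * dirichlet_coeff I s \<beta> (Suc n)"
    unfolding \<beta>_def by (rule sum_increment[OF assms(1) Suc.prems])
  also have "(\<Sum>i\<in>I. \<alpha> i * (s i * dirichlet_coeff I s (\<alpha>(i := \<alpha> i + 1)) (Suc n)))
      = real (Suc (Suc n)) * dirichlet_coeff I s \<alpha> (Suc (Suc n))"
    by (simp add: dirichlet_coeff.simps(2)[of I s \<alpha> "Suc n"] mult.assoc del: dirichlet_coeff.simps(2))
  also have "(\<Sum>i\<in>I. \<beta> i * s i * dirichlet_coeff I s (\<beta>(i := \<beta> i + 1)) n) = real (Suc n) * dirichlet_coeff I s \<beta> (Suc n)"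
    by simp
  finally have "real (Suc (Suc n)) * dirichlet_coeff I s \<beta> (Suc (Suc n))
     = real (Suc (Suc n)) * (dirichlet_coeff I s \<alpha> (Suc (Suc n)) + s k * dirichlet_coeff I s \<beta> (Suc n))"
    by (simp add: algebra_simps del: dirichlet_coeff.simps)
  then show ?case
    unfolding \<beta>_def[symmetric] by (simp del: dirichlet_coeff.simps)
qed

lemma dirichlet_coeff_increment_sum:
  assumes "finite I" "k \<in> I"
  shows "dirichlet_coeff I s (\<alpha>(k := \<alpha> k + 1)) n = (\<Sum>j\<le>n. s k ^ j * dirichlet_coeff I s \<alpha> (n - j))"
proof (induction n)
  case (Suc n)
  show ?case
    unfolding dirichlet_coeff_increment[OF assms] Suc sum.atMost_Suc_shift
    by (simp add: sum_distrib_left mult.assoc del: dirichlet_coeff.simps)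
qed simp

text \<open>The logarithmic derivative of the product is the generating function of the power sums. Since the
  coefficient at 0 is 1, the identity expresses the power sum of order \<open>n + 1\<close> through coefficients of order
  at most \<open>n + 1\<close> and power sums of lower order.\<close>

lemma dirichlet_coeff_newton:
  assumes "finite I"
  shows "real (Suc n) * dirichlet_coeff I s \<alpha> (Suc n) = (\<Sum>j\<le>n. (\<Sum>i\<in>I. \<alpha> i * s i ^ Suc j) * dirichlet_coeff I s \<alpha> (n - j))"
proof -
  have "real (Suc n) * dirichlet_coeff I s \<alpha> (Suc n) = (\<Sum>i\<in>I. \<alpha> i * s i * dirichlet_coeff I s (\<alpha>(i := \<alpha> i + 1)) n)"
    by simp
  also have "\<dots> = (\<Sum>i\<in>I. \<Sum>j\<le>n. \<alpha> i * s i ^ Suc j * dirichlet_coeff I s \<alpha> (n - j))"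
    by (intro sum.cong refl) (simp add: dirichlet_coeff_increment_sum[OF assms] sum_distrib_left mult_ac del: dirichlet_coeff.simps)
  also have "\<dots> = (\<Sum>j\<le>n. (\<Sum>i\<in>I. \<alpha> i * s i ^ Suc j) * dirichlet_coeff I s \<alpha> (n - j))"
    by (subst sum.swap) (simp add: sum_distrib_right)
  finally show ?thesis .
qed

lemma integrable_dirichlet_bounded:
  fixes f :: "('i \<Rightarrow> real) \<Rightarrow> real"
  assumes "finite I" "I \<noteq> {}" "\<And>i. i \<in> I \<Longrightarrow> \<alpha> i > 0"
    and [measurable]: "f \<in> borel_measurable (\<Pi>\<^sub>M i\<in>I. borel)"
    and bound: "\<And>q. \<forall>i\<in>I. 0 \<le> q i \<and> q i \<le> 1 \<Longrightarrow> \<bar>f q\<bar> \<le> B"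
  shows "integrable (dirichlet I \<alpha>) f"
proof -
  interpret prob_space "dirichlet I \<alpha>"
    by (rule prob_space_dirichlet) (use assms in auto)
  have "AE q in dirichlet I \<alpha>. norm (f q) \<le> B"
  proof (rule eventually_mono[OF AE_dirichlet[OF assms(1,2)]])
    fix q :: "'i \<Rightarrow> real" assume *: "(\<forall>i\<in>I. 0 < q i) \<and> (\<Sum>i\<in>I. q i) = 1"
    then have "q i \<le> 1" if "i \<in> I" for i
      using member_le_sum[of i I q] that assms(1) by (auto simp: less_imp_le)
    with * show "norm (f q) \<le> B"
      unfolding real_norm_def by (intro bound) (auto simp: less_imp_le)
  qed (use assms in auto)
  moreover have "f \<in> borel_measurable (dirichlet I \<alpha>)"
    by measurable
  ultimately show ?thesis
    by (intro integrable_const_bound)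
qed

text \<open>Splitting off one factor of the power and absorbing \<open>q k\<close> into the density turns the moment into a
  combination of moments of order \<open>n\<close> with respect to incremented parameters.\<close>

lemma dirichlet_moment:
  fixes s :: "'i \<Rightarrow> real"
  assumes "finite I" "I \<noteq> {}" "\<And>i. i \<in> I \<Longrightarrow> \<alpha> i > 0"
  shows "(\<integral>q. (\<Sum>i\<in>I. q i * s i) ^ n \<partial>dirichlet I \<alpha>)
       = fact n / pochhammer (\<Sum>i\<in>I. \<alpha> i) n * dirichlet_coeff I s \<alpha> n"
  using assms(3)
proof (induction n arbitrary: \<alpha>)
  case 0
  interpret prob_space "dirichlet I \<alpha>"
    by (rule prob_space_dirichlet) (use assms 0 in auto)
  show ?case by (simp add: prob_space)
next
  case (Suc n)
  let ?Y = "\<lambda>q. \<Sum>i\<in>I. q i * s i"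
  let ?a = "\<Sum>i\<in>I. \<alpha> i"
  have a: "?a > 0"
    using assms(1,2) Suc.prems by (intro sum_pos) auto
  have int: "integrable (dirichlet I \<alpha>) (\<lambda>q. s k * (q k * ?Y q ^ n))" if "k \<in> I" for k
  proof (rule integrable_dirichlet_bounded[where B = "\<bar>s k\<bar> * (1 * (\<Sum>i\<in>I. \<bar>s i\<bar>) ^ n)"])
    fix q assume q: "\<forall>i\<in>I. 0 \<le> q i \<and> q i \<le> (1::real)"
    have "\<bar>q i * s i\<bar> \<le> \<bar>s i\<bar>" if "i \<in> I" for i
      using q that by (auto simp: abs_mult intro!: mult_left_le_one_le)
    then have "\<bar>?Y q\<bar> \<le> (\<Sum>i\<in>I. \<bar>s i\<bar>)"
      by (intro order_trans[OF sum_abs] sum_mono) auto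
    then show "\<bar>s k * (q k * ?Y q ^ n)\<bar> \<le> \<bar>s k\<bar> * (1 * (\<Sum>i\<in>I. \<bar>s i\<bar>) ^ n)"
      using q that unfolding abs_mult power_abs
      by (intro mult_left_mono mult_mono power_mono) auto
  qed (use assms Suc.prems that in \<open>auto, measurable\<close>)
  have "(\<integral>q. ?Y q ^ Suc n \<partial>dirichlet I \<alpha>) = (\<integral>q. (\<Sum>k\<in>I. s k * (q k * ?Y q ^ n)) \<partial>dirichlet I \<alpha>)"
    by (simp add: sum_distrib_right mult_ac)
  also have "\<dots> = (\<Sum>k\<in>I. s k * (\<integral>q. q k * ?Y q ^ n \<partial>dirichlet I \<alpha>))"
    using int by (subst Bochner_Integration.integral_sum) auto
  also have "\<dots> = (\<Sum>k\<in>I. s k * (\<alpha> k / ?a * (\<integral>q. ?Y q ^ n \<partial>dirichlet I (\<alpha>(k := \<alpha> k + 1)))))"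
  proof (intro sum.cong refl)
    fix k assume k: "k \<in> I"
    show "s k * (\<integral>q. q k * ?Y q ^ n \<partial>dirichlet I \<alpha>)
        = s k * (\<alpha> k / ?a * (\<integral>q. ?Y q ^ n \<partial>dirichlet I (\<alpha>(k := \<alpha> k + 1))))"
      using assms(1) Suc.prems k by (subst integral_dirichlet_shift) (auto, measurable)
  qed
  also have "\<dots> = (\<Sum>k\<in>I. s k * (\<alpha> k / ?a * (fact n / pochhammer (?a + 1) n * dirichlet_coeff I s (\<alpha>(k := \<alpha> k + 1)) n)))"
  proof (intro sum.cong refl)
    fix k assume k: "k \<in> I"
    have "(\<Sum>i\<in>I. (\<alpha>(k := \<alpha> k + 1)) i) = ?a + 1"
      using sum_increment[OF assms(1) k, of \<alpha> "\<lambda>_. 1"] by simp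
    moreover have "(\<alpha>(k := \<alpha> k + 1)) i > 0" if "i \<in> I" for i
      using Suc.prems[OF that] by auto
    ultimately show "s k * (\<alpha> k / ?a * (\<integral>q. ?Y q ^ n \<partial>dirichlet I (\<alpha>(k := \<alpha> k + 1))))
       = s k * (\<alpha> k / ?a * (fact n / pochhammer (?a + 1) n * dirichlet_coeff I s (\<alpha>(k := \<alpha> k + 1)) n))"
      by (subst Suc.IH) auto
  qed
  also have "\<dots> = fact n / (?a * pochhammer (?a + 1) n) * (\<Sum>k\<in>I. \<alpha> k * s k * dirichlet_coeff I s (\<alpha>(k := \<alpha> k + 1)) n)"
    by (simp add: sum_distrib_left mult_ac)
  also have "\<dots> = fact (Suc n) / pochhammer ?a (Suc n) * dirichlet_coeff I s \<alpha> (Suc n)"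
  proof -
    have "fact (Suc n) / p * (x / real (Suc n)) = fact n / p * x" for x p :: real
      by simp
    then show ?thesis
      by (simp only: pochhammer_rec dirichlet_coeff.simps(2))
  qed
  finally show ?case .
qed


section \<open>From word frequencies to moments of the mixing measure\<close>

text \<open>Expanding the product over the positions of a document shows that the mass function is the moment
  tensor of the random word distribution \<open>\<Sum>\<theta>. q \<theta> *\<^sub>R \<theta>\<close>.\<close>

lemma lda_pmf_multilinear:
  fixes G :: "(real ^ 'v) pmf" and t :: "nat \<Rightarrow> real ^ 'v"
  assumes "a > 0" "finite (set_pmf G)"
  shows "(\<integral>q. (\<Prod>j=1..N. \<Sum>\<theta>\<in>set_pmf G. q \<theta> * (\<theta> \<bullet> t j)) \<partial>dirichlet (set_pmf G) (\<lambda>\<theta>. a * pmf G \<theta>))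
       = (\<Sum>x\<in>{1..N} \<rightarrow>\<^sub>E UNIV. (\<Prod>j=1..N. t j $ x j) * lda_pmf a G N x)"
proof -
  let ?I = "set_pmf G" and ?D = "dirichlet (set_pmf G) (\<lambda>\<theta>. a * pmf G \<theta>)"
  let ?p = "\<lambda>x q. \<Prod>j=1..N. \<Sum>\<theta>\<in>?I. q \<theta> * \<theta> $ x j"
  have pos: "a * pmf G \<theta> > 0" if "\<theta> \<in> ?I" for \<theta>
    using assms that by (simp add: pmf_positive)
  have int: "integrable ?D (?p x)" for x
  proof (rule integrable_dirichlet_bounded[where B = "\<Prod>j=1..N. \<Sum>\<theta>\<in>?I. \<bar>\<theta> $ x j\<bar>"])
    fix q :: "real ^ 'v \<Rightarrow> real" assume q: "\<forall>\<theta>\<in>?I. 0 \<le> q \<theta> \<and> q \<theta> \<le> 1"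
    have "\<bar>\<Sum>\<theta>\<in>?I. q \<theta> * \<theta> $ x j\<bar> \<le> (\<Sum>\<theta>\<in>?I. \<bar>\<theta> $ x j\<bar>)" for j
      using q by (intro order_trans[OF sum_abs] sum_mono) (auto simp: abs_mult intro!: mult_left_le_one_le)
    then show "\<bar>?p x q\<bar> \<le> (\<Prod>j=1..N. \<Sum>\<theta>\<in>?I. \<bar>\<theta> $ x j\<bar>)"
      unfolding abs_prod by (intro prod_mono) auto
  qed (use assms pos in \<open>auto simp: set_pmf_not_empty, measurable\<close>)
  have "(\<Prod>j=1..N. \<Sum>\<theta>\<in>?I. q \<theta> * (\<theta> \<bullet> t j)) = (\<Sum>x\<in>{1..N} \<rightarrow>\<^sub>E UNIV. (\<Prod>j=1..N. t j $ x j) * ?p x q)" for q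
  proof -
    have "(\<Sum>\<theta>\<in>?I. q \<theta> * (\<theta> \<bullet> t j)) = (\<Sum>v\<in>UNIV. t j $ v * (\<Sum>\<theta>\<in>?I. q \<theta> * \<theta> $ v))" for j
      unfolding inner_vec_def sum_distrib_left by (subst sum.swap) (simp add: mult_ac)
    then show ?thesis
      by (simp add: prod_sum_PiE prod.distrib)
  qed
  then show ?thesis
    using int by (simp add: lda_pmf_def Bochner_Integration.integral_sum)
qed

lemma inner_one_simplex: "\<theta> \<in> prob_simplex \<Longrightarrow> \<theta> \<bullet> 1 = 1"
  by (simp add: prob_simplex_def inner_vec_def)

text \<open>The random word distribution has total mass one, so contracting the last \<open>N - n\<close> slots of its moment
  tensor with the constant vector 1 gives the moments of every order \<open>n \<le> N\<close>.\<close>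

lemma lda_pmf_moment:
  fixes G :: "(real ^ 'v) pmf" and t :: "real ^ 'v"
  assumes "a > 0" "finite (set_pmf G)" "set_pmf G \<subseteq> prob_simplex" "n \<le> N"
  shows "(\<integral>q. (\<Sum>\<theta>\<in>set_pmf G. q \<theta> * (\<theta> \<bullet> t)) ^ n \<partial>dirichlet (set_pmf G) (\<lambda>\<theta>. a * pmf G \<theta>))
       = (\<Sum>x\<in>{1..N} \<rightarrow>\<^sub>E UNIV. (\<Prod>j=1..N. (if j \<le> n then t else 1) $ x j) * lda_pmf a G N x)"
proof -
  let ?I = "set_pmf G" and ?D = "dirichlet (set_pmf G) (\<lambda>\<theta>. a * pmf G \<theta>)"
  let ?t = "\<lambda>j. if j \<le> n then t else 1"
  have pos: "a * pmf G \<theta> > 0" if "\<theta> \<in> ?I" for \<theta>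
    using assms that by (simp add: pmf_positive)
  have "(\<integral>q. (\<Sum>\<theta>\<in>?I. q \<theta> * (\<theta> \<bullet> t)) ^ n \<partial>?D) = (\<integral>q. (\<Prod>j=1..N. \<Sum>\<theta>\<in>?I. q \<theta> * (\<theta> \<bullet> ?t j)) \<partial>?D)"
  proof (rule integral_cong_AE)
    show "AE q in ?D. (\<Sum>\<theta>\<in>?I. q \<theta> * (\<theta> \<bullet> t)) ^ n = (\<Prod>j=1..N. \<Sum>\<theta>\<in>?I. q \<theta> * (\<theta> \<bullet> ?t j))"
    proof (rule eventually_mono[OF AE_dirichlet])
      fix q assume "(\<forall>\<theta>\<in>?I. 0 < q \<theta>) \<and> (\<Sum>\<theta>\<in>?I. q \<theta>) = (1 :: real)"
      moreover have "(\<Sum>\<theta>\<in>?I. q \<theta> * (\<theta> \<bullet> 1)) = (\<Sum>\<theta>\<in>?I. q \<theta>)"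
        using assms(3) by (intro sum.cong) (auto simp: inner_one_simplex)
      ultimately have "(\<Sum>\<theta>\<in>?I. q \<theta> * (\<theta> \<bullet> ?t j)) = (if j \<le> n then \<Sum>\<theta>\<in>?I. q \<theta> * (\<theta> \<bullet> t) else 1)" for j
        by simp
      then have "(\<Prod>j=1..N. \<Sum>\<theta>\<in>?I. q \<theta> * (\<theta> \<bullet> ?t j))
          = (\<Prod>j\<in>{1..N} \<inter> {j. j \<le> n}. \<Sum>\<theta>\<in>?I. q \<theta> * (\<theta> \<bullet> t))"
        by (simp only: prod.inter_restrict[OF finite_atLeastAtMost] mem_Collect_eq)
      also have "{1..N} \<inter> {j. j \<le> n} = {1..n}"
        using assms(4) by auto
      finally show "(\<Sum>\<theta>\<in>?I. q \<theta> * (\<theta> \<bullet> t)) ^ n = (\<Prod>j=1..N. \<Sum>\<theta>\<in>?I. q \<theta> * (\<theta> \<bullet> ?t j))"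
        by simp
    qed (use assms pos in \<open>auto simp: set_pmf_not_empty\<close>)
  qed measurable
  also have "\<dots> = (\<Sum>x\<in>{1..N} \<rightarrow>\<^sub>E UNIV. (\<Prod>j=1..N. ?t j $ x j) * lda_pmf a G N x)"
    by (rule lda_pmf_multilinear[OF assms(1,2)])
  finally show ?thesis .
qed

text \<open>The mass functions determine the Dirichlet moments up to order \<open>N\<close>, and these determine the power
  sums recursively by \<open>dirichlet_coeff_newton\<close>.\<close>

lemma lda_pmf_eq_power_moments:
  fixes G H :: "(real ^ 'v) pmf"
  assumes "a > 0" and G: "finite (set_pmf G)" "set_pmf G \<subseteq> prob_simplex"
    and H: "finite (set_pmf H)" "set_pmf H \<subseteq> prob_simplex"
    and eq: "lda_pmf a G N = lda_pmf a H N" and "n \<le> N"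
  shows "(\<integral>\<theta>. (\<theta> \<bullet> t) ^ n \<partial>measure_pmf G) = (\<integral>\<theta>. (\<theta> \<bullet> t) ^ n \<partial>measure_pmf H)"
proof -
  let ?d = "\<lambda>G. dirichlet_coeff (set_pmf G) (\<lambda>\<theta>. \<theta> \<bullet> t) (\<lambda>\<theta>. a * pmf G \<theta>)"
  let ?P = "\<lambda>G j. \<Sum>\<theta>\<in>set_pmf G. (a * pmf G \<theta>) * (\<theta> \<bullet> t) ^ j"
  have P: "?P G j = a * (\<integral>\<theta>. (\<theta> \<bullet> t) ^ j \<partial>measure_pmf G)" if "finite (set_pmf G)" for G j
    using that by (subst integral_measure_pmf_real[OF that]) (auto simp: sum_distrib_left mult_ac)
  have d: "fact n / pochhammer a n * ?d G n
      = (\<integral>q. (\<Sum>\<theta>\<in>set_pmf G. q \<theta> * (\<theta> \<bullet> t)) ^ n \<partial>dirichlet (set_pmf G) (\<lambda>\<theta>. a * pmf G \<theta>))"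
    if "finite (set_pmf G)" for G n
  proof -
    have "(\<Sum>\<theta>\<in>set_pmf G. a * pmf G \<theta>) = a"
      using sum_pmf_eq_1[OF that order_refl] by (simp add: sum_distrib_left[symmetric])
    then show ?thesis
      using that assms(1) by (subst dirichlet_moment) (auto simp: set_pmf_not_empty pmf_positive)
  qed
  have d_eq: "?d G n = ?d H n" if "n \<le> N" for n
  proof -
    have "fact n / pochhammer a n * ?d G n = fact n / pochhammer a n * ?d H n"
      unfolding d[OF G(1)] d[OF H(1)]
      using lda_pmf_moment[OF assms(1) G that] lda_pmf_moment[OF assms(1) H that] eq by simp
    then show ?thesis
      using pochhammer_pos[OF assms(1), of n] by simp
  qed
  have "?P G (Suc m) = ?P H (Suc m)" if "Suc m \<le> N" for m
    using that
  proof (induction m rule: less_induct)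
    case (less m)
    have newton: "real (Suc m) * ?d F (Suc m) = (\<Sum>j<m. ?P F (Suc j) * ?d F (m - j)) + ?P F (Suc m)"
      if "finite (set_pmf F)" for F
      unfolding dirichlet_coeff_newton[OF that] lessThan_Suc_atMost[symmetric] by simp
    have "(\<Sum>j<m. ?P G (Suc j) * ?d G (m - j)) = (\<Sum>j<m. ?P H (Suc j) * ?d H (m - j))"
      using less.IH less.prems d_eq by (intro sum.cong) auto
    with newton[OF G(1)] newton[OF H(1)] d_eq[OF less.prems] show ?case by simp
  qed
  then have "?P G n = ?P H n" if "n > 0"
    using that \<open>n \<le> N\<close> by (cases n) (auto simp del: power_Suc)
  with P[OF G(1), of n] P[OF H(1), of n] assms(1) show ?thesis
    by (cases "n = 0") auto
qed

section \<open>Forms and polarization\<close>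

text \<open>Differentiating the identity at \<open>t\<close> in the direction \<open>u\<close> lowers the exponent by one and moves the
  factor \<open>u \<bullet> x\<close> into the weights; iterating replaces the power by a product.\<close>

lemma polarization:
  fixes c :: "'b::real_inner \<Rightarrow> real"
  assumes "finite S" "\<And>t. (\<Sum>x\<in>S. c x * (x \<bullet> t) ^ length us) = 0"
  shows "(\<Sum>x\<in>S. c x * (\<Prod>u\<leftarrow>us. u \<bullet> x)) = 0"
  using assms(2)
proof (induction us arbitrary: c)
  case Nil
  then show ?case by simp
next
  case (Cons u us)
  have "(\<Sum>x\<in>S. c x * (u \<bullet> x) * (x \<bullet> t) ^ length us) = 0" for t
  proof -
    let ?g = "\<lambda>z. \<Sum>x\<in>S. c x * (x \<bullet> t + z * (x \<bullet> u)) ^ Suc (length us)"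
    have "?g z = 0" for z
      using Cons.prems[of "t + z *\<^sub>R u"] by (simp add: inner_add_right)
    then have "(?g has_real_derivative 0) (at 0)"
      by (simp del: power_Suc)
    moreover have "(?g has_real_derivative
        (\<Sum>x\<in>S. c x * (real (Suc (length us)) * (x \<bullet> t) ^ length us * (x \<bullet> u)))) (at 0)"
      by (auto intro!: derivative_eq_intros sum.cong simp del: power_Suc)
    ultimately have "(\<Sum>x\<in>S. c x * (real (Suc (length us)) * (x \<bullet> t) ^ length us * (x \<bullet> u))) = 0"
      by (rule DERIV_unique[symmetric])
    also have "(\<Sum>x\<in>S. c x * (real (Suc (length us)) * (x \<bullet> t) ^ length us * (x \<bullet> u)))
       = real (Suc (length us)) * (\<Sum>x\<in>S. c x * (u \<bullet> x) * (x \<bullet> t) ^ length us)"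
      by (simp add: sum_distrib_left inner_commute mult_ac del: of_nat_Suc)
    finally show ?thesis by (simp del: of_nat_Suc)
  qed
  from Cons.IH[OF this] show ?case
    by (simp add: mult.assoc)
qed

text \<open>The homogeneous polynomial functions of degree \<open>n\<close>. On the simplex, where \<open>x \<bullet> 1 = 1\<close>, they
  comprise all polynomial functions of degree at most \<open>n\<close>.\<close>

inductive form :: "nat \<Rightarrow> ('b::real_inner \<Rightarrow> real) \<Rightarrow> bool" where
  form_one: "form 0 (\<lambda>x. 1)"
| form_inner: "form n f \<Longrightarrow> form (Suc n) (\<lambda>x. (u \<bullet> x) * f x)"
| form_add: "form n f \<Longrightarrow> form n g \<Longrightarrow> form n (\<lambda>x. f x + g x)"
| form_scale: "form n f \<Longrightarrow> form n (\<lambda>x. c * f x)"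

lemma form_expectation_eq:
  fixes G H :: "'b::real_inner pmf"
  assumes "finite (set_pmf G)" "finite (set_pmf H)"
    and power: "\<And>n t. n \<le> N \<Longrightarrow> (\<integral>\<theta>. (\<theta> \<bullet> t) ^ n \<partial>measure_pmf G) = (\<integral>\<theta>. (\<theta> \<bullet> t) ^ n \<partial>measure_pmf H)"
    and "form n f" "n \<le> N"
  shows "(\<integral>\<theta>. f \<theta> \<partial>measure_pmf G) = (\<integral>\<theta>. f \<theta> \<partial>measure_pmf H)"
proof -
  let ?S = "set_pmf G \<union> set_pmf H"
  let ?c = "\<lambda>x. pmf G x - pmf H x"
  have diff: "(\<integral>\<theta>. f \<theta> \<partial>measure_pmf G) - (\<integral>\<theta>. f \<theta> \<partial>measure_pmf H) = (\<Sum>x\<in>?S. ?c x * f x)" for f :: "'b \<Rightarrow> real"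
    using assms(1,2)
    by (subst (1 2) integral_measure_pmf_real[where A = ?S]) (auto simp: algebra_simps sum_subtractf)
  \<comment> \<open>Linear factors of the form are moved into \<open>us\<close> until a pure product of linear functionals remains.\<close>
  have "(\<Sum>x\<in>?S. ?c x * ((\<Prod>u\<leftarrow>us. u \<bullet> x) * f x)) = 0" if "length us + n \<le> N" for us
    using assms(4) that
  proof (induction arbitrary: us)
    case form_one
    then have "(\<Sum>x\<in>?S. ?c x * (x \<bullet> t) ^ length us) = 0" for t
      unfolding diff[symmetric] using power by simp
    from polarization[OF _ this] assms(1,2) show ?case by simp
  next
    case (form_inner n f u)
    from form_inner.IH[of "u # us"] form_inner.prems show ?case by (simp add: mult_ac)
  next
    case (form_add n f g)
    from form_add.IH[OF form_add.prems] show ?case by (simp add: distrib_left sum.distrib)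
  next
    case (form_scale n f c)
    have "(\<Sum>x\<in>?S. ?c x * ((\<Prod>u\<leftarrow>us. u \<bullet> x) * (c * f x)))
        = c * (\<Sum>x\<in>?S. ?c x * ((\<Prod>u\<leftarrow>us. u \<bullet> x) * f x))"
      by (simp add: sum_distrib_left mult_ac)
    with form_scale.IH[OF form_scale.prems] show ?case by simp
  qed
  from this[of "[]"] diff[of f] assms(5) show ?thesis by simp
qed

lemma form_mult:
  assumes "form m f" "form n g"
  shows "form (m + n) (\<lambda>x. f x * g x)"
  using assms(1)
proof induction
  case form_one
  then show ?case using assms(2) by simp
next
  case (form_inner m f u)
  from form.form_inner[OF form_inner.IH, of u] show ?case by (simp add: mult.assoc)
next
  case (form_add m f h)
  from form.form_add[OF form_add.IH] show ?case by (simp add: distrib_right)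
next
  case (form_scale m f c)
  from form.form_scale[OF form_scale.IH, of c] show ?case by (simp add: mult.assoc)
qed

lemma form_linear: "form 1 (\<lambda>x. u \<bullet> x)"
  using form_inner[OF form_one, of u] by simp

section \<open>Isolating a point by a form\<close>

definition isolates :: "nat \<Rightarrow> 'b::real_inner \<Rightarrow> 'b set \<Rightarrow> bool" where
  "isolates n x T \<longleftrightarrow> (\<exists>f. form n f \<and> f x = 1 \<and> (\<forall>y\<in>T. f y = 0))"

lemma isolates_Un:
  assumes "isolates m x S" "isolates n x T"
  shows "isolates (m + n) x (S \<union> T)"
proof -
  obtain f g where f: "form m f" "f x = 1" "\<forall>y\<in>S. f y = 0" and g: "form n g" "g x = 1" "\<forall>y\<in>T. g y = 0"
    using assms unfolding isolates_def by blast
  show ?thesis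
    unfolding isolates_def
    by (intro exI[of _ "\<lambda>y. f y * g y"] conjI form_mult f(1) g(1)) (use f g in auto)
qed

lemma isolates_subset: "isolates n x T \<Longrightarrow> S \<subseteq> T \<Longrightarrow> isolates n x S"
  unfolding isolates_def by blast

lemma isolates_empty:
  assumes "x \<in> prob_simplex"
  shows "isolates n x {}"
proof (induction n)
  case 0
  then show ?case unfolding isolates_def using form_one by blast
next
  case (Suc n)
  then obtain f where f: "form n f" "f x = 1"
    unfolding isolates_def by blast
  have "form (Suc n) (\<lambda>y. (1 \<bullet> y) * f y)"
    using form_inner[OF f(1)] .
  moreover have "(1 \<bullet> x) * f x = 1"
    using f(2) inner_one_simplex[OF assms] by (simp add: inner_commute)
  ultimately show ?case
    unfolding isolates_def by blast
qed

lemma isolates_mono: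
  assumes "isolates m x T" "m \<le> n" "x \<in> prob_simplex"
  shows "isolates n x T"
  using isolates_Un[OF assms(1) isolates_empty[OF assms(3), of "n - m"]] assms(2) by simp

text \<open>A product of \<open>p\<close> linear forms, each of which vanishes on a block of \<open>m\<close> points.\<close>

lemma isolates_blocks:
  assumes block: "\<And>S. S \<subseteq> T \<Longrightarrow> card S \<le> m \<Longrightarrow> isolates 1 x S"
    and "finite T" "card T \<le> p * m" "x \<in> prob_simplex"
  shows "isolates p x T"
  using assms(1-3)
proof (induction p arbitrary: T)
  case 0
  then show ?case by (simp add: isolates_empty assms(4))
next
  case (Suc p)
  obtain S where S: "S \<subseteq> T" "card S = min m (card T)"
    using obtain_subset_with_card_n[of "min m (card T)" T] by auto
  have "isolates 1 x S"
    using S by (intro Suc.prems) auto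
  moreover have "isolates p x (T - S)"
  proof (rule Suc.IH)
    have "card (T - S) = card T - card S"
      using S Suc.prems by (simp add: card_Diff_subset finite_subset)
    then show "card (T - S) \<le> p * m"
      using S(2) Suc.prems(3) by (auto simp: min_def split: if_splits)
  qed (use Suc.prems in auto)
  ultimately have "isolates (1 + p) x (S \<union> (T - S))"
    by (rule isolates_Un)
  moreover have "S \<union> (T - S) = T"
    using S(1) by blast
  ultimately show ?case by simp
qed

lemma separating_functional:
  fixes x :: "'b::euclidean_space"
  assumes "x \<notin> span T"
  obtains u where "u \<bullet> x = 1" "\<And>y. y \<in> T \<Longrightarrow> u \<bullet> y = 0"
proof -
  obtain y z where y: "y \<in> span T" and z: "\<And>w. w \<in> span T \<Longrightarrow> orthogonal z w" and x: "x = y + z"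
    using orthogonal_subspace_decomp_exists[of T x] by blast
  have "z \<noteq> 0"
    using assms x y by auto
  have zx: "z \<bullet> x = z \<bullet> z"
    using z[OF y] x by (simp add: inner_add_right orthogonal_def)
  show thesis
  proof
    show "((1 / (z \<bullet> z)) *\<^sub>R z) \<bullet> x = 1"
      using \<open>z \<noteq> 0\<close> zx by simp
    show "((1 / (z \<bullet> z)) *\<^sub>R z) \<bullet> y = 0" if "y \<in> T" for y
      using z[OF span_base[OF that]] by (simp add: orthogonal_def)
  qed
qed

lemma isolates_not_in_span:
  fixes x :: "'b::euclidean_space"
  assumes "x \<notin> span T"
  shows "isolates 1 x T"
proof -
  obtain u where "u \<bullet> x = 1" "\<And>y. y \<in> T \<Longrightarrow> u \<bullet> y = 0"
    using separating_functional[OF assms] by blast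
  then show ?thesis
    unfolding isolates_def by (intro exI[of _ "\<lambda>y. u \<bullet> y"] conjI form_linear) auto
qed

lemma simplex_in_span_singleton:
  assumes "x \<in> prob_simplex" "y \<in> prob_simplex" "x \<in> span {y}"
  shows "x = y"
proof -
  obtain c where c: "x = c *\<^sub>R y"
    using assms(3) by (auto simp: span_singleton)
  have "c = 1"
    using inner_one_simplex[OF assms(1)] inner_one_simplex[OF assms(2)] c by simp
  with c show ?thesis by simp
qed

lemma zero_notin_simplex: "0 \<notin> prob_simplex"
  by (simp add: prob_simplex_def)

lemma isolates_card:
  assumes "finite T" "T \<subseteq> prob_simplex" "x \<in> prob_simplex" "x \<notin> T" "card T \<le> n"
  shows "isolates n x T"
proof (rule isolates_blocks[where m = 1])
  fix S assume S: "S \<subseteq> T" "card S \<le> 1"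
  have "finite S" using S assms(1) by (simp add: finite_subset)
  then have "S = {} \<or> (\<exists>y. S = {y})"
    using S(2) by (auto simp: le_Suc_eq card_1_singleton_iff)
  then show "isolates 1 x S"
  proof
    assume "\<exists>y. S = {y}"
    then obtain y where y: "S = {y}" by blast
    with S assms have "x \<notin> span {y}"
      using simplex_in_span_singleton[of x y] by auto
    then show ?thesis unfolding y by (rule isolates_not_in_span)
  qed (simp add: isolates_empty assms(3))
qed (use assms in auto)

section \<open>Mixing measures with equal moments\<close>

definition moments_agree :: "nat \<Rightarrow> 'b::real_inner pmf \<Rightarrow> 'b pmf \<Rightarrow> bool" where
  "moments_agree N G H \<longleftrightarrow> (\<forall>n\<le>N. \<forall>f. form n f \<longrightarrow> (\<integral>x. f x \<partial>measure_pmf G) = (\<integral>x. f x \<partial>measure_pmf H))"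

lemma moments_agree_sym: "moments_agree N G H \<Longrightarrow> moments_agree N H G"
  by (simp add: moments_agree_def)

lemma moments_agree_mono: "moments_agree N G H \<Longrightarrow> n \<le> N \<Longrightarrow> moments_agree n G H"
  unfolding moments_agree_def by (meson order_trans)

lemma expectation_supported_at:
  fixes f :: "'b \<Rightarrow> real"
  assumes "\<And>y. y \<in> set_pmf G \<Longrightarrow> y \<noteq> x \<Longrightarrow> f y = 0"
  shows "(\<integral>y. f y \<partial>measure_pmf G) = f x * pmf G x"
  by (subst integral_measure_pmf_real[where A = "{x}"]) (use assms in auto)

lemma pmf_eq_if_isolated:
  assumes "moments_agree N G H" "n \<le> N" "isolates n x (set_pmf G \<union> set_pmf H - {x})"
  shows "pmf G x = pmf H x"
proof -
  obtain f where f: "form n f" "f x = 1" "\<And>y. y \<in> set_pmf G \<union> set_pmf H - {x} \<Longrightarrow> f y = 0"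
    using assms(3) unfolding isolates_def by blast
  have "(\<integral>y. f y \<partial>measure_pmf G) = (\<integral>y. f y \<partial>measure_pmf H)"
    using assms(1,2) f(1) by (simp add: moments_agree_def)
  then show ?thesis
    using f(2,3) by (simp add: expectation_supported_at[of _ x])
qed

lemma eq_if_all_isolated:
  assumes "moments_agree N G H" "\<And>x. x \<in> set_pmf G \<union> set_pmf H \<Longrightarrow> isolates N x (set_pmf G \<union> set_pmf H - {x})"
  shows "G = H"
proof (rule pmf_eqI)
  fix x
  show "pmf G x = pmf H x"
  proof (cases "x \<in> set_pmf G \<union> set_pmf H")
    case True
    then show ?thesis using pmf_eq_if_isolated[OF assms(1) order_refl assms(2)] by blast
  next
    case False
    then show ?thesis by (auto simp: set_pmf_iff)
  qed
qed

lemma nonneg_form_vanishes: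
  assumes "moments_agree N G H" "n \<le> N" "form n f" "finite (set_pmf G)"
    and nonneg: "\<And>y. y \<in> set_pmf G \<Longrightarrow> 0 \<le> f y" and H: "\<And>y. y \<in> set_pmf H \<Longrightarrow> f y = 0"
    and x: "x \<in> set_pmf G"
  shows "f x = 0"
proof -
  have "(\<Sum>y\<in>set_pmf G. f y * pmf G y) = (\<integral>y. f y \<partial>measure_pmf G)"
    using assms(4) by (subst integral_measure_pmf_real) auto
  also have "\<dots> = (\<integral>y. f y \<partial>measure_pmf H)"
    using assms(1-3) by (simp add: moments_agree_def)
  also have "\<dots> = 0"
    using H by (subst integral_measure_pmf_real[where A = "{}"]) auto
  finally have "f x * pmf G x = 0"
    using sum_nonneg_eq_0_iff[of "set_pmf G" "\<lambda>y. f y * pmf G y"] assms(4) nonneg x by simp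
  with x show ?thesis by (simp add: set_pmf_iff)
qed

lemma isolated_notin_set_pmf:
  assumes "moments_agree (2 * n) G H" "finite (set_pmf G)" "isolates n x (set_pmf H)"
  shows "x \<notin> set_pmf G"
proof
  assume x: "x \<in> set_pmf G"
  obtain f where f: "form n f" "f x = 1" "\<And>y. y \<in> set_pmf H \<Longrightarrow> f y = 0"
    using assms(3) unfolding isolates_def by blast
  have "form (2 * n) (\<lambda>y. f y * f y)"
    using form_mult[OF f(1) f(1)] by (simp add: mult_2)
  from nonneg_form_vanishes[OF assms(1) order_refl this assms(2) _ _ x] f(2,3) show False
    by simp
qed

lemma set_pmf_subset_span:
  fixes G H :: "'b::euclidean_space pmf"
  assumes "moments_agree 2 G H" "finite (set_pmf G)"
  shows "set_pmf G \<subseteq> span (set_pmf H)"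
  using isolated_notin_set_pmf[of 1 G H] isolates_not_in_span assms by auto

lemma span_set_pmf_eq:
  fixes G H :: "'b::euclidean_space pmf"
  assumes "moments_agree 2 G H" "finite (set_pmf G)" "finite (set_pmf H)"
  shows "span (set_pmf G) = span (set_pmf H)"
  using set_pmf_subset_span[OF assms(1,2)] set_pmf_subset_span[OF moments_agree_sym[OF assms(1)] assms(3)]
  by (simp add: span_eq)

section \<open>Point configurations\<close>

lemma isolates_independent:
  fixes S :: "'b::euclidean_space set"
  assumes "independent S" "x \<in> S"
  shows "isolates 1 x (S - {x})"
  using assms by (intro isolates_not_in_span) (auto simp: dependent_def)

text \<open>The values \<open>u x \<bullet> y\<close> are, up to nonzero factors, the coordinates of \<open>y\<close> in the basis \<open>A\<close>. If their
  pairwise products vanish then \<open>y\<close> is a multiple of a single element of \<open>A\<close>, and multiples within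
  the simplex are trivial.\<close>

lemma mem_independent_if_products_vanish:
  assumes ind: "independent A" "finite A" "A \<subseteq> prob_simplex" and y: "y \<in> span A" "y \<in> prob_simplex"
    and u: "\<And>x. x \<in> A \<Longrightarrow> u x \<bullet> x \<noteq> 0" "\<And>x z. x \<in> A \<Longrightarrow> z \<in> A - {x} \<Longrightarrow> u x \<bullet> z = 0"
    and prod: "\<And>x z. x \<in> A \<Longrightarrow> z \<in> A - {x} \<Longrightarrow> (u x \<bullet> y) * (u z \<bullet> y) = 0"
  shows "y \<in> A"
proof -
  obtain c where c: "y = (\<Sum>x\<in>A. c x *\<^sub>R x)"
    using y(1) span_finite[OF ind(2)] by auto
  have uy: "u x \<bullet> y = c x * (u x \<bullet> x)" if "x \<in> A" for x
  proof -
    have "u x \<bullet> y = (\<Sum>z\<in>A. c z * (u x \<bullet> z))"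
      unfolding c by (simp add: inner_sum_right)
    also have "\<dots> = (\<Sum>z\<in>A. if z = x then c x * (u x \<bullet> x) else 0)"
      using u(2)[OF that] by (intro sum.cong) auto
    finally show ?thesis using that ind(2) by simp
  qed
  have "\<exists>x\<in>A. c x \<noteq> 0"
  proof (rule ccontr)
    assume "\<not> (\<exists>x\<in>A. c x \<noteq> 0)"
    then have "y = 0" unfolding c by simp
    with y(2) show False by (simp add: zero_notin_simplex)
  qed
  then obtain x where x: "x \<in> A" "c x \<noteq> 0" by blast
  have "c z = 0" if "z \<in> A - {x}" for z
    using prod[OF x(1) that] uy[OF x(1)] uy[of z] u(1)[of z] u(1)[OF x(1)] x that by auto
  then have "y = (\<Sum>z\<in>A. if z = x then c x *\<^sub>R x else 0)"
    unfolding c by (intro sum.cong) auto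
  then have "y \<in> span {x}"
    using x ind(2) by (simp add: span_mul span_base)
  then show ?thesis
    using simplex_in_span_singleton[of y x] y(2) x(1) ind(3) by auto
qed


lemma independent_if_dual:
  fixes A :: "'b::euclidean_space set"
  assumes "\<And>x. x \<in> A \<Longrightarrow> u x \<bullet> x \<noteq> 0" "\<And>x z. x \<in> A \<Longrightarrow> z \<in> A - {x} \<Longrightarrow> u x \<bullet> z = 0"
  shows "independent A"
proof
  assume "dependent A"
  then obtain x where x: "x \<in> A" "x \<in> span (A - {x})"
    by (auto simp: dependent_def)
  have "span (A - {x}) \<subseteq> {z. u x \<bullet> z = 0}"
    using assms(2)[OF x(1)] by (intro span_minimal subspace_hyperplane) auto
  with x assms(1) show False by auto
qed

text \<open>The point \<open>x\<close> can be completed to a basis of the span by elements of \<open>A\<close>.\<close>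

lemma isolates_part_of_spanning_set:
  fixes A :: "'b::euclidean_space set"
  assumes "finite A" "x \<in> span A" "x \<noteq> 0"
  obtains A' where "A' \<subseteq> A" "card A' + 1 = dim A" "x \<notin> A'" "isolates 1 x A'"
proof -
  have "independent {x}" using assms(3) by simp
  then obtain B where B: "{x} \<subseteq> B" "B \<subseteq> insert x A" "independent B" "insert x A \<subseteq> span B"
    using maximal_independent_subset_extend[of "{x}" "insert x A"] by blast
  have "finite B" using B(2) assms(1) finite_subset by blast
  have "card B = dim (insert x A)"
    using B by (intro basis_card_eq_dim) auto
  also have "\<dots> = dim A"
    using assms(2) by (simp add: dim_insert)
  finally have "card (B - {x}) + 1 = dim A"
    using B(1) \<open>finite B\<close> card_Suc_Diff1[of B x] by simp
  then show thesis
    using B isolates_independent[OF B(3), of x] by (intro that[of "B - {x}"]) auto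
qed

text \<open>Interpolation on \<open>C\<close> survives additional zeros at the price of one point of \<open>C\<close> for each zero. For a
  new zero \<open>d\<close>, either all isolating forms vanish at \<open>d\<close>, or one of them, belonging to a point \<open>x0\<close>,
  does not. In the latter case \<open>x0\<close> is given up, and its form corrects the others so that they vanish at \<open>d\<close>.\<close>

lemma isolates_thin:
  assumes "finite C" "finite D" "\<And>x. x \<in> C \<Longrightarrow> isolates p x (C - {x})"
  obtains C' where "C' \<subseteq> C" "card C \<le> card C' + card D" "\<And>x. x \<in> C' \<Longrightarrow> isolates p x ((C' - {x}) \<union> D)"
proof -
  have "\<exists>C'\<subseteq>C. card C \<le> card C' + card D \<and> (\<forall>x\<in>C'. isolates p x ((C' - {x}) \<union> D))"
    using assms(2)
  proof induction
    case empty
    then show ?case using assms(3) by auto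
  next
    case (insert d D)
    then obtain C' where C': "C' \<subseteq> C" "card C \<le> card C' + card D"
      and iso: "\<And>x. x \<in> C' \<Longrightarrow> isolates p x ((C' - {x}) \<union> D)" by blast
    show ?case
    proof (cases "\<forall>x\<in>C'. isolates p x ((C' - {x}) \<union> insert d D)")
      case True
      then show ?thesis using C' insert.hyps by (intro exI[of _ C']) auto
    next
      case False
      then obtain x0 where x0: "x0 \<in> C'" "\<not> isolates p x0 ((C' - {x0}) \<union> insert d D)" by blast
      obtain f0 where f0: "form p f0" "f0 x0 = 1" "\<And>y. y \<in> (C' - {x0}) \<union> D \<Longrightarrow> f0 y = 0"
        using iso[OF x0(1)] unfolding isolates_def by blast
      have "f0 d \<noteq> 0"
        using x0(2) f0 unfolding isolates_def by auto
      have "isolates p x ((C' - {x0} - {x}) \<union> insert d D)" if x: "x \<in> C' - {x0}" for x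
      proof -
        obtain f where f: "form p f" "f x = 1" "\<And>y. y \<in> (C' - {x}) \<union> D \<Longrightarrow> f y = 0"
          using iso[of x] x unfolding isolates_def by blast
        let ?g = "\<lambda>y. f y + (- f d / f0 d) * f0 y"
        have "form p ?g"
          by (intro form_add form_scale f(1) f0(1))
        moreover have "?g x = 1"
          using f(2) f0(3)[of x] x by simp
        moreover have "?g y = 0" if "y \<in> (C' - {x0} - {x}) \<union> insert d D" for y
          using that f(3)[of y] f0(3)[of y] \<open>f0 d \<noteq> 0\<close> by (cases "y = d") auto
        ultimately show ?thesis
          unfolding isolates_def by blast
      qed
      moreover have "card C' = Suc (card (C' - {x0}))"
        using card.remove[OF finite_subset[OF C'(1) assms(1)] x0(1)] .
      ultimately show ?thesis
        using C' insert.hyps by (intro exI[of _ "C' - {x0}"]) auto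
    qed
  qed
  then show thesis using that by blast
qed

lemma span_insert_exchange:
  fixes z :: "'b::euclidean_space"
  assumes "z \<in> span (insert y T)" "z \<notin> span T"
  shows "span (insert z T) = span (insert y T)"
proof -
  have "y \<in> span (insert z T)"
    using in_span_insert[OF assms] .
  then show ?thesis
    using assms(1) by (auto simp: span_eq span_superset subset_iff span_base)
qed

text \<open>Downward induction on the dimension. Let \<open>U\<close> be the flat spanned by \<open>T\<close>. The flats spanned by
  \<open>U\<close> and one more point of \<open>B\<close> cover \<open>B\<close> and meet pairwise only in \<open>U\<close>. If there are \<open>k\<close> of them, then
  adding up their inequalities counts the points outside \<open>U\<close> at least once for \<open>B\<close> and at most once for \<open>A\<close>,
  but those in \<open>U\<close> exactly \<open>k\<close> times for both. Subtracting the comparison of \<open>A\<close> and \<open>B\<close> as a whole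
  leaves \<open>k - 1\<close> times the claim, and \<open>k \<ge> 2\<close> because \<open>U\<close> has codimension at least two. The excess \<open>d\<close>
  makes the induction work for sets of different size.\<close>

lemma flat_inequality:
  fixes A B :: "'b::euclidean_space set"
  assumes fin: "finite A" "finite B" and card: "card A \<le> card B + d"
    and hyper: "\<And>T. T \<subseteq> B \<Longrightarrow> dim T + 1 = dim B \<Longrightarrow> card (B \<inter> span T) + d \<le> card (A \<inter> span T)"
    and T: "T \<subseteq> B" "dim T < dim B"
  shows "card (B \<inter> span T) + d \<le> card (A \<inter> span T)"
  using T
proof (induction "dim B - dim T" arbitrary: T rule: less_induct)
  case less
  show ?case
  proof (cases "dim T + 1 = dim B")
    case True
    then show ?thesis using hyper less.prems by blast
  next
    case False
    let ?U = "span T"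
    define \<F> where "\<F> = (\<lambda>y. span (insert y T)) ` (B - ?U)"
    have fin\<F>: "finite \<F>" using fin by (simp add: \<F>_def)
    have W: "card (B \<inter> W) + d \<le> card (A \<inter> W)" "?U \<subseteq> W" if "W \<in> \<F>" for W
    proof -
      obtain y where y: "y \<in> B" "y \<notin> ?U" "W = span (insert y T)"
        using \<open>W \<in> \<F>\<close> by (auto simp: \<F>_def)
      have "dim (insert y T) = dim T + 1"
        using y by (simp add: dim_insert)
      then show "card (B \<inter> W) + d \<le> card (A \<inter> W)"
        unfolding y(3) using less.prems y False by (intro less.hyps) auto
      show "?U \<subseteq> W" unfolding y(3) by (intro span_mono) auto
    qed
    have same: "W = span (insert z T)" if "W \<in> \<F>" "z \<in> W" "z \<notin> ?U" for W z
      using that span_insert_exchange[of z _ T] by (auto simp: \<F>_def)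
    have notin: "\<exists>y\<in>B. y \<notin> span S" if "dim S < dim B" for S
      using that dim_mono[of B S] by (auto simp: subset_iff not_le[symmetric])
    have two: "2 \<le> card \<F>"
    proof -
      obtain y where y: "y \<in> B" "y \<notin> ?U" using notin less.prems by blast
      then have "dim (insert y T) < dim B"
        using less.prems False by (simp add: dim_insert)
      then obtain z where z: "z \<in> B" "z \<notin> span (insert y T)" using notin by blast
      then have "z \<notin> ?U" using span_mono[of T "insert y T"] by auto
      then have "{span (insert y T), span (insert z T)} \<subseteq> \<F>"
        using y z by (auto simp: \<F>_def)
      moreover have "span (insert y T) \<noteq> span (insert z T)"
        using z(2) span_base[of z "insert z T"] by auto
      ultimately show ?thesis
        using card_mono[OF fin\<F>, of "{span (insert y T), span (insert z T)}"] by simp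
    qed
    have split: "card (X \<inter> W) = card (X \<inter> W - ?U) + card (X \<inter> ?U)" if "W \<in> \<F>" "finite X" for X W
    proof -
      have "X \<inter> W \<inter> ?U = X \<inter> ?U" using W(2)[OF that(1)] by blast
      then show ?thesis
        using card_Int_Diff[of "X \<inter> W" ?U] that(2) by simp
    qed
    have "(\<Sum>W\<in>\<F>. card (A \<inter> W - ?U)) = card (\<Union>W\<in>\<F>. A \<inter> W - ?U)"
    proof (rule card_UN_disjoint[symmetric, OF fin\<F>])
      show "\<forall>W\<in>\<F>. \<forall>W'\<in>\<F>. W \<noteq> W' \<longrightarrow> (A \<inter> W - ?U) \<inter> (A \<inter> W' - ?U) = {}"
        using same by blast
    qed (use fin in auto)
    also have "\<dots> \<le> card (A - ?U)"
      using fin by (intro card_mono) auto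
    finally have sumA: "(\<Sum>W\<in>\<F>. card (A \<inter> W - ?U)) \<le> card (A - ?U)" .
    have "B - ?U \<subseteq> (\<Union>W\<in>\<F>. B \<inter> W - ?U)"
      by (auto simp: \<F>_def span_base)
    then have "card (B - ?U) \<le> card (\<Union>W\<in>\<F>. B \<inter> W - ?U)"
      using fin fin\<F> by (intro card_mono) auto
    also have "\<dots> \<le> (\<Sum>W\<in>\<F>. card (B \<inter> W - ?U))"
      by (rule card_UN_le[OF fin\<F>])
    finally have sumB: "card (B - ?U) \<le> (\<Sum>W\<in>\<F>. card (B \<inter> W - ?U))" .
    have "(\<Sum>W\<in>\<F>. card (B \<inter> W) + d) \<le> (\<Sum>W\<in>\<F>. card (A \<inter> W))"
      using W(1) by (rule sum_mono)
    then have "(\<Sum>W\<in>\<F>. card (B \<inter> W - ?U)) + card \<F> * (card (B \<inter> ?U) + d)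
        \<le> (\<Sum>W\<in>\<F>. card (A \<inter> W - ?U)) + card \<F> * card (A \<inter> ?U)"
      using fin by (simp add: split sum.distrib algebra_simps)
    with sumA sumB have main: "card (B - ?U) + card \<F> * (card (B \<inter> ?U) + d)
        \<le> card (A - ?U) + card \<F> * card (A \<inter> ?U)" by linarith
    have cards: "card A = card (A \<inter> ?U) + card (A - ?U)" "card B = card (B \<inter> ?U) + card (B - ?U)"
      using fin by (simp_all add: card_Int_Diff)
    obtain m where m: "card \<F> = Suc m" "m > 0"
      using two by (cases "card \<F>") auto
    have "m * (card (B \<inter> ?U) + d) \<le> m * card (A \<inter> ?U)"
      using main cards card unfolding m(1) mult_Suc by linarith
    then show ?thesis using m(2) by simp
  qed
qed

section \<open>Distinct, independent and anchored topics\<close>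

locale topic_mixtures =
  fixes G0 G :: "(real ^ 'v) pmf"
  assumes fin0: "finite (set_pmf G0)" and fin: "finite (set_pmf G)"
    and simplex0: "set_pmf G0 \<subseteq> prob_simplex" and simplex: "set_pmf G \<subseteq> prob_simplex"
begin

lemma eq_if_exact_order:
  assumes "moments_agree (2 * card (set_pmf G0) - 1) G G0" "card (set_pmf G) \<le> card (set_pmf G0)"
  shows "G = G0"
proof (rule eq_if_all_isolated[OF assms(1)])
  fix x assume x: "x \<in> set_pmf G \<union> set_pmf G0"
  have "card (set_pmf G \<union> set_pmf G0 - {x}) \<le> 2 * card (set_pmf G0) - 1"
    using x card_Un_le[of "set_pmf G" "set_pmf G0"] assms(2) fin fin0 by simp
  then show "isolates (2 * card (set_pmf G0) - 1) x (set_pmf G \<union> set_pmf G0 - {x})"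
    using x fin fin0 simplex simplex0 by (intro isolates_card) auto
qed

lemma eq_if_subset:
  assumes "moments_agree N G G0" "set_pmf G \<subseteq> set_pmf G0"
    "\<And>x. x \<in> set_pmf G0 \<Longrightarrow> isolates N x (set_pmf G0 - {x})"
  shows "G = G0"
  using assms by (intro eq_if_all_isolated[OF assms(1)]) (auto simp: Un_absorb1)

lemma eq_if_double_order:
  assumes "moments_agree (2 * card (set_pmf G0)) G G0"
  shows "G = G0"
proof (rule eq_if_subset[OF assms])
  show "set_pmf G \<subseteq> set_pmf G0"
  proof
    fix x assume x: "x \<in> set_pmf G"
    show "x \<in> set_pmf G0"
    proof (rule ccontr)
      assume "x \<notin> set_pmf G0"
      then have "isolates (card (set_pmf G0)) x (set_pmf G0)"
        using x fin0 simplex simplex0 by (intro isolates_card) auto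
      with isolated_notin_set_pmf[OF assms fin] x show False by blast
    qed
  qed
  show "isolates (2 * card (set_pmf G0)) x (set_pmf G0 - {x})" if "x \<in> set_pmf G0" for x
    using that fin0 simplex0 by (intro isolates_card) (auto simp: card_Diff_singleton)
qed

text \<open>Products of two distinct dual functionals vanish on all topics, but they have no sign on the simplex, so
  it is their squares, of degree four, that force them to vanish on the atoms of \<open>G\<close>.\<close>

lemma eq_if_independent:
  assumes agree: "moments_agree 4 G G0" and ind: "independent (set_pmf G0)"
  shows "G = G0"
proof (rule eq_if_subset[OF moments_agree_mono[OF agree, of 1]])
  let ?A = "set_pmf G0"
  have "\<exists>u. u \<bullet> x = 1 \<and> (\<forall>z\<in>?A - {x}. u \<bullet> z = 0)" if "x \<in> ?A" for x
  proof -
    have "x \<notin> span (?A - {x})"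
      using ind that by (auto simp: dependent_def)
    then obtain u where "u \<bullet> x = 1" "\<And>z. z \<in> ?A - {x} \<Longrightarrow> u \<bullet> z = 0"
      using separating_functional by blast
    then show ?thesis by blast
  qed
  then obtain u where u: "\<And>x. x \<in> ?A \<Longrightarrow> u x \<bullet> x = 1"
      "\<And>x z. x \<in> ?A \<Longrightarrow> z \<in> ?A - {x} \<Longrightarrow> u x \<bullet> z = 0"
    by metis
  show "set_pmf G \<subseteq> ?A"
  proof
    fix y assume y: "y \<in> set_pmf G"
    show "y \<in> ?A"
    proof (rule mem_independent_if_products_vanish[OF ind fin0 simplex0])
      show "y \<in> span ?A"
        using set_pmf_subset_span[OF moments_agree_mono[OF agree, of 2] fin] y by auto
      show "(u x \<bullet> y) * (u z \<bullet> y) = 0" if xz: "x \<in> ?A" "z \<in> ?A - {x}" for x z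
      proof -
        let ?f = "\<lambda>w. (u x \<bullet> w) * (u z \<bullet> w)"
        have f0: "?f w = 0" if "w \<in> ?A" for w
          using u xz that by (cases "w = x") auto
        have "form 2 ?f"
          using form_mult[OF form_linear form_linear] by (simp add: numeral_2_eq_2)
        from form_mult[OF this this] have "form 4 (\<lambda>w. ?f w * ?f w)" by simp
        from nonneg_form_vanishes[OF agree order_refl this fin _ _ y] f0
        show ?thesis by simp
      qed
    qed (use y simplex u in auto)
  qed
qed (use isolates_independent[OF ind] in auto)

text \<open>The coordinates of the anchor words are dual functionals, up to nonzero factors, and nonnegative on the whole
  simplex. Hence their products need not be squared.\<close>

lemma eq_if_anchor_word:
  assumes agree: "moments_agree 2 G G0" and anchor: "anchor_word (set_pmf G0)"
  shows "G = G0"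
proof (rule eq_if_subset[OF moments_agree_mono[OF agree, of 1]])
  let ?A = "set_pmf G0"
  obtain v where v: "\<And>x. x \<in> ?A \<Longrightarrow> 0 < x $ v x" "\<And>x z. x \<in> ?A \<Longrightarrow> z \<in> ?A - {x} \<Longrightarrow> z $ v x = 0"
    using anchor unfolding anchor_word_def by metis
  let ?u = "\<lambda>x. axis (v x) 1 :: real ^ 'v"
  have u: "?u x \<bullet> z = z $ v x" for x z
    by (simp add: inner_axis')
  have ind: "independent ?A"
  proof (rule independent_if_dual[where u = ?u])
    show "?u x \<bullet> x \<noteq> 0" if "x \<in> ?A" for x
      using v(1)[OF that] by (simp add: u)
    show "?u x \<bullet> z = 0" if "x \<in> ?A" "z \<in> ?A - {x}" for x z
      using v(2)[OF that] by (simp add: u)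
  qed
  show "isolates 1 x (?A - {x})" if "x \<in> ?A" for x
    using isolates_independent[OF ind that] .
  show "set_pmf G \<subseteq> ?A"
  proof
    fix y assume y: "y \<in> set_pmf G"
    show "y \<in> ?A"
    proof (rule mem_independent_if_products_vanish[OF ind fin0 simplex0, where u = ?u])
      show "y \<in> span ?A"
        using set_pmf_subset_span[OF agree fin] y by auto
      show "?u x \<bullet> x \<noteq> 0" if "x \<in> ?A" for x
        using v(1)[OF that] by (simp add: u)
      show "(?u x \<bullet> y) * (?u z \<bullet> y) = 0" if xz: "x \<in> ?A" "z \<in> ?A - {x}" for x z
      proof -
        let ?f = "\<lambda>w. (?u x \<bullet> w) * (?u z \<bullet> w)"
        have form: "form 2 ?f"
          using form_mult[OF form_linear form_linear] by (simp add: numeral_2_eq_2)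
        have "?f w = 0" if "w \<in> ?A" for w
          using v(2) xz that by (cases "w = x") (auto simp: u)
        moreover have "0 \<le> ?f w" if "w \<in> set_pmf G" for w
          using simplex that by (auto simp: u prob_simplex_def)
        ultimately show ?thesis
          using nonneg_form_vanishes[OF agree order_refl form fin _ _ y] by blast
      qed
    qed (use y simplex v in \<open>auto simp: u\<close>)
  qed
qed simp

text \<open>Both measures have atoms spanning the same space, of dimension \<open>R\<close>. To isolate an atom \<open>x\<close>, one linear
  form vanishes on \<open>R - 1\<close> atoms of \<open>G0\<close>, a second one on \<open>R - 1\<close> atoms of \<open>G\<close>, and each of the remaining
  atoms, of which there are at most \<open>card (set_pmf G) + card (set_pmf G0) + 1 - 2 * R\<close>, costs one more linear form.\<close>

lemma eq_if_rank_order: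
  assumes agree: "moments_agree N G G0" and "2 \<le> N"
    and N: "card (set_pmf G) + card (set_pmf G0) + 3 \<le> N + 2 * dim (set_pmf G0)"
  shows "G = G0"
proof (rule eq_if_all_isolated[OF agree])
  let ?A = "set_pmf G0" and ?B = "set_pmf G"
  fix x assume x: "x \<in> ?B \<union> ?A"
  have span: "span ?B = span ?A"
    using span_set_pmf_eq[OF moments_agree_mono[OF agree \<open>2 \<le> N\<close>] fin fin0] .
  then have dim: "dim ?B = dim ?A"
    by (metis dim_span)
  have xs: "x \<in> prob_simplex" using x simplex simplex0 by auto
  then have "x \<noteq> 0" using zero_notin_simplex by auto
  have xA: "x \<in> span ?A" using x span by (auto intro: span_base)
  then have xB: "x \<in> span ?B" using span by simp
  obtain A' where A': "A' \<subseteq> ?A" "card A' + 1 = dim ?A" "x \<notin> A'" "isolates 1 x A'"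
    by (rule isolates_part_of_spanning_set[OF fin0 xA \<open>x \<noteq> 0\<close>])
  obtain B' where B': "B' \<subseteq> ?B" "card B' + 1 = dim ?A" "x \<notin> B'" "isolates 1 x B'"
    unfolding dim[symmetric] by (rule isolates_part_of_spanning_set[OF fin xB \<open>x \<noteq> 0\<close>])
  let ?R = "(?A - A' - {x}) \<union> (?B - B' - {x})"
  have finAB: "finite A'" "finite B'"
    using A'(1) B'(1) fin fin0 finite_subset by auto
  have "card ?R \<le> card (?A - A' - {x}) + card (?B - B' - {x})"
    by (rule card_Un_le)
  \<comment> \<open>The strict inequality comes from \<open>x\<close> itself, an atom of at least one of the two measures.\<close>
  also have "\<dots> < card (?A - A') + card (?B - B')"
  proof (cases "x \<in> ?A")
    case True
    then show ?thesis
      using A'(3) fin0 fin by (intro add_less_le_mono card_Diff1_less card_Diff1_le) auto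
  next
    case False
    then show ?thesis
      using x B'(3) fin0 fin by (intro add_le_less_mono card_Diff1_less card_Diff1_le) auto
  qed
  also have "\<dots> = (card ?A - card A') + (card ?B - card B')"
    using A'(1) B'(1) finAB by (simp add: card_Diff_subset)
  finally have "card ?R + 2 \<le> N"
    using A'(2) B'(2) N card_mono[OF fin0 A'(1)] card_mono[OF fin B'(1)] by linarith
  moreover have "isolates (card ?R) x ?R"
    using xs simplex simplex0 fin fin0 by (intro isolates_card) auto
  then have "isolates (1 + 1 + card ?R) x (A' \<union> B' \<union> ?R)"
    by (intro isolates_Un A' B')
  ultimately have "isolates N x (A' \<union> B' \<union> ?R)"
    by (rule_tac isolates_mono[OF _ _ xs]) auto
  then show "isolates N x (?B \<union> ?A - {x})"
    by (rule isolates_subset) auto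
qed

end

section \<open>Topics in general position\<close>

text \<open>If any \<open>r\<close> topics are independent, a linear form can vanish at \<open>r - 1\<close> topics without vanishing at a
  further one, so forms of degree \<open>N\<close> can avoid \<open>N * (r - 1)\<close> topics. The bound on \<open>N\<close> asks that this number be at least
  \<open>2 * K0 - 1\<close>, as many points as would have to be avoided if all atoms of both measures
  were in general position.\<close>

locale kruskal_mixtures = topic_mixtures G0 G for G0 G :: "(real ^ 'v) pmf" +
  fixes N r :: nat
  assumes agree: "moments_agree N G G0"
    and r: "2 \<le> r" "r \<le> card (set_pmf G0)"
    and general_position: "\<And>T. T \<subseteq> set_pmf G0 \<Longrightarrow> card T = r \<Longrightarrow> independent T"
    and fewer: "card (set_pmf G) \<le> card (set_pmf G0)"
    and N: "2 * card (set_pmf G0) \<le> N * (r - 1) + 1"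
begin

abbreviation "A \<equiv> set_pmf G0"
abbreviation "B \<equiv> set_pmf G"

lemma independent_small:
  assumes "T \<subseteq> A" "card T \<le> r"
  shows "independent T"
proof -
  obtain T' where "T \<subseteq> T'" "T' \<subseteq> A" "card T' = r"
    using exists_subset_between[of T r A] assms r fin0 by auto
  then show ?thesis
    using general_position independent_mono by blast
qed

lemma isolates_general_position:
  assumes "x \<in> A" "T \<subseteq> A - {x}" "card T \<le> p * (r - 1)"
  shows "isolates p x T"
proof (rule isolates_blocks[where m = "r - 1"])
  fix S assume S: "S \<subseteq> T" "card S \<le> r - 1"
  have "S \<subseteq> A" using S(1) assms(2) by blast
  then have "finite S" using fin0 by (rule finite_subset)
  then have "independent (insert x S)"
    using S assms r by (intro independent_small) (auto simp: card_insert_if)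
  moreover have "insert x S - {x} = S" using S assms by auto
  ultimately show "isolates 1 x S"
    using isolates_independent[of "insert x S" x] by auto
next
  have "T \<subseteq> A" using assms(2) by blast
  then show "finite T" using fin0 by (rule finite_subset)
qed (use assms simplex0 in auto)

lemma three_le_N: "3 \<le> N"
proof (rule ccontr)
  assume "\<not> 3 \<le> N"
  then have "N * (r - 1) \<le> 2 * (r - 1)" by (intro mult_le_mono1) auto
  with N r show False by linarith
qed

text \<open>Suppose that, outside the hyperplane \<open>u \<bullet> x = 0\<close>, there are fewer atoms of \<open>G\<close> than topics. A form of
  degree \<open>N\<close> is then assembled from \<open>u\<close> and two factors of about half of the remaining degree. The first
  factor is chosen by interpolation on topics, thinned out so that it vanishes on all atoms of \<open>G\<close> outside the
  hyperplane and on many topics; the second one vanishes on the topics that are still left, except for one.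
  The form isolates that topic, a contradiction. In matrix terms, this compares the ranks of the flattenings
  of the two tensors contracted with \<open>u\<close>.\<close>

lemma hyperplane_inequality:
  assumes few: "card {y\<in>B. u \<bullet> y \<noteq> 0} + r \<le> card A + 1"
  shows "card {x\<in>A. u \<bullet> x \<noteq> 0} \<le> card {y\<in>B. u \<bullet> y \<noteq> 0}"
proof (rule ccontr)
  let ?A1 = "{x\<in>A. u \<bullet> x \<noteq> 0}" and ?B1 = "{y\<in>B. u \<bullet> y \<noteq> 0}"
  assume "\<not> card ?A1 \<le> card ?B1"
  then have lt: "card ?B1 < card ?A1" by simp
  define p where "p = (N - 1) div 2"
  define q where "q = N - 1 - p"
  define m where "m = r - 1"
  have m: "r = m + 1" "m > 0" using r(1) by (auto simp: m_def)
  have pq: "p + q + 1 = N" "q = p \<or> q = p + 1"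
  proof -
    have "N - 1 = 2 * p + (N - 1) mod 2" "(N - 1) mod 2 < 2"
      unfolding p_def by simp_all
    then show "p + q + 1 = N" "q = p \<or> q = p + 1"
      using three_le_N unfolding q_def by linarith+
  qed
  have "N * m = p * m + q * m + m"
    by (simp add: pq(1)[symmetric] algebra_simps)
  moreover have "p * m \<le> q * m" "q * m \<le> p * m + m"
    using pq(2) by (auto simp: algebra_simps)
  ultimately have pqm: "2 * card A \<le> p * m + q * m + m + 1" "p * m \<le> q * m" "q * m \<le> p * m + m"
    using N by (simp_all add: m_def)
  have A1: "finite ?A1" "card ?A1 \<le> card A" and B1: "finite ?B1"
    using fin fin0 by (auto intro!: card_mono)
  \<comment> \<open>The largest size for which interpolation on topics by forms of degree \<open>p\<close> is guaranteed.\<close>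
  obtain A2 where A2: "A2 \<subseteq> ?A1" "card A2 = min (card ?A1) (p * m + 1)"
    by (rule obtain_subset_with_card_n[OF min.cobounded1[of "card ?A1" "p * m + 1"]])
  have fin2: "finite A2" using A2(1) A1(1) finite_subset by blast
  have "isolates p x (A2 - {x})" if "x \<in> A2" for x
    using A2 fin2 that by (intro isolates_general_position) (auto simp: m_def)
  then obtain A3 where A3: "A3 \<subseteq> A2" "card A2 \<le> card A3 + card ?B1"
      "\<And>x. x \<in> A3 \<Longrightarrow> isolates p x ((A3 - {x}) \<union> ?B1)"
    using isolates_thin[OF fin2 B1, of p] by blast
  have "card ?B1 < card A2"
    using lt A2(2) pqm few m by linarith
  with A3(2) have "card A3 > 0" by linarith
  then obtain x where x: "x \<in> A3" by (auto simp: card_gt_0_iff)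
  then have xA1: "x \<in> ?A1" and xA: "x \<in> A" using A3(1) A2(1) by auto
  have "card (?A1 - A3) = card ?A1 - card A3"
    using A3(1) A2(1) A1(1) by (intro card_Diff_subset) (auto intro: finite_subset)
  also have "\<dots> \<le> q * m"
    using A3(2) A2(2) A1(2) pqm few m lt by linarith
  finally have "isolates q x (?A1 - A3)"
    using x xA by (intro isolates_general_position) (auto simp: m_def)
  then obtain g where g: "form q g" "g x = 1" "\<And>y. y \<in> ?A1 - A3 \<Longrightarrow> g y = 0"
    unfolding isolates_def by blast
  obtain f where f: "form p f" "f x = 1" "\<And>y. y \<in> (A3 - {x}) \<union> ?B1 \<Longrightarrow> f y = 0"
    using A3(3)[OF x] unfolding isolates_def by blast
  let ?h = "\<lambda>y. (u \<bullet> y) * (f y * g y)"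
  have "form N ?h"
    using form_inner[OF form_mult[OF f(1) g(1)], of u] pq(1) by simp
  then have "(\<integral>y. ?h y \<partial>measure_pmf G) = (\<integral>y. ?h y \<partial>measure_pmf G0)"
    using agree unfolding moments_agree_def by blast
  moreover have "(\<integral>y. ?h y \<partial>measure_pmf G0) = ?h x * pmf G0 x"
    using f(3) g(3) by (intro expectation_supported_at) auto
  moreover have "(\<integral>y. ?h y \<partial>measure_pmf G) = 0"
    using f(3) by (subst integral_measure_pmf_real[where A = "{}"]) auto
  ultimately show False
    using f(2) g(2) xA1 by (auto simp: set_pmf_iff)
qed

text \<open>Within the common span, a hyperplane spanned by atoms of \<open>G\<close> contains at least \<open>r - 1\<close> of them, so
  \<open>hyperplane_inequality\<close> applies to it. By \<open>flat_inequality\<close> the comparison descends to the line through a single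
  atom of \<open>G\<close>. That line contains a topic, which must be the atom.\<close>

lemma eq_if_general_position: "G = G0"
proof (rule eq_if_subset[OF agree])
  have span: "span B = span A"
    using span_set_pmf_eq[OF moments_agree_mono[OF agree, of 2] fin fin0] three_le_N by simp
  then have dim_eq: "dim B = dim A"
    by (metis dim_span)
  obtain T0 where T0: "T0 \<subseteq> A" "card T0 = r"
    using obtain_subset_with_card_n[OF r(2)] by auto
  then have "r \<le> dim A"
    using independent_card_le_dim[OF T0(1) general_position[OF T0]] by simp
  then have dim: "r \<le> dim B" using dim_eq by simp
  let ?d = "card A - card B"
  have hyper: "card (B \<inter> span T) + ?d \<le> card (A \<inter> span T)" if T: "T \<subseteq> B" "dim T + 1 = dim B" for T
  proof -
    have finT: "finite T" using T(1) fin finite_subset by blast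
    have "\<not> B \<subseteq> span T"
      using dim_mono[of B T] T(2) by auto
    then obtain y where y: "y \<in> B" "y \<notin> span T" by blast
    \<comment> \<open>Within the span of the atoms, the hyperplane orthogonal to \<open>u\<close> is the span of \<open>T\<close>.\<close>
    obtain u where u: "u \<bullet> y = 1" "\<And>z. z \<in> T \<Longrightarrow> u \<bullet> z = 0"
      using separating_functional[OF y(2)] by blast
    have uT: "u \<bullet> z = 0" if "z \<in> span T" for z
      using span_minimal[of T "{z. u \<bullet> z = 0}"] subspace_hyperplane u(2) that by blast
    have "span (insert y T) = span B"
      using T y by (intro dim_eq_span) (auto simp: dim_insert)
    then have ker: "u \<bullet> z \<noteq> 0 \<longleftrightarrow> z \<notin> span T" if z: "z \<in> span B" for z
    proof -
      obtain k where k: "z - k *\<^sub>R y \<in> span T"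
        using \<open>span (insert y T) = span B\<close> z span_breakdown_eq[of z y T] by auto
      have "u \<bullet> z = k"
        using uT[OF k] u(1) by (simp add: inner_diff_right)
      then show ?thesis using k uT by auto
    qed
    have AB: "{z\<in>A. u \<bullet> z \<noteq> 0} = A - span T" "{z\<in>B. u \<bullet> z \<noteq> 0} = B - span T"
      using ker span by (auto intro: span_base)
    have cards: "card A = card (A \<inter> span T) + card (A - span T)" "card B = card (B \<inter> span T) + card (B - span T)"
      using fin fin0 by (simp_all add: card_Int_Diff)
    have "dim T \<le> card T" using dim_le_card'[OF finT] .
    also have "\<dots> \<le> card (B \<inter> span T)"
      using T(1) fin by (intro card_mono) (auto intro: span_base)
    finally have "r \<le> card (B \<inter> span T) + 1" using T(2) dim by linarith
    then have "card (A - span T) \<le> card (B - span T)"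
      using hyperplane_inequality[of u] cards fewer unfolding AB by linarith
    then show ?thesis using cards fewer by linarith
  qed
  show "B \<subseteq> A"
  proof
    fix y assume y: "y \<in> B"
    then have ys: "y \<in> prob_simplex" using simplex by auto
    have "dim {y} < dim B"
      using dim_le_card'[of "{y}"] dim r(1) by simp
    then have "card (B \<inter> span {y}) + ?d \<le> card (A \<inter> span {y})"
      using y fewer by (intro flat_inequality[OF fin0 fin _ hyper]) simp_all
    moreover have "card (B \<inter> span {y}) > 0"
      using y fin by (auto simp: card_gt_0_iff intro: span_base)
    ultimately have "A \<inter> span {y} \<noteq> {}"
      by (metis add_gr_0 card.empty not_le)
    then obtain x where x: "x \<in> A" "x \<in> span {y}" by blast
    then have "x = y"
      using simplex_in_span_singleton ys simplex0 by blast
    with x show "y \<in> A" by simp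
  qed
  show "isolates N x (A - {x})" if "x \<in> A" for x
    using that N fin0 r by (intro isolates_general_position) auto
qed

end

section \<open>Identifiable document lengths\<close>

lemma lda_pmf_eq_moments_agree:
  fixes G H :: "(real ^ 'v) pmf"
  assumes "a > 0" and G: "finite (set_pmf G)" "set_pmf G \<subseteq> prob_simplex"
    and H: "finite (set_pmf H)" "set_pmf H \<subseteq> prob_simplex"
    and "lda_pmf a G N = lda_pmf a H N"
  shows "moments_agree N G H"
  unfolding moments_agree_def
proof (intro allI impI)
  fix n and f :: "real ^ 'v \<Rightarrow> real"
  assume "n \<le> N" "form n f"
  then show "(\<integral>x. f x \<partial>measure_pmf G) = (\<integral>x. f x \<partial>measure_pmf H)"
    by (intro form_expectation_eq[OF G(1) H(1) lda_pmf_eq_power_moments[OF assms]])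
qed

lemma identifiable_uptoI:
  fixes G0 :: "(real ^ 'v) pmf"
  assumes "a > 0" "finite (set_pmf G0)" "set_pmf G0 \<subseteq> prob_simplex"
    and "\<And>G. topic_mixtures G0 G \<Longrightarrow> card (set_pmf G) \<le> K \<Longrightarrow> moments_agree N G G0 \<Longrightarrow> G = G0"
  shows "identifiable_upto a K G0 N"
  unfolding identifiable_upto_def
proof (intro ballI impI)
  fix G :: "(real ^ 'v) pmf"
  assume "G \<in> mixing_upto K" and eq: "lda_pmf a G N = lda_pmf a G0 N"
  then have G: "finite (set_pmf G)" "set_pmf G \<subseteq> prob_simplex" "card (set_pmf G) \<le> K"
    by (auto simp: mixing_upto_def mixing_exact_def)
  then show "G = G0"
    using assms(2,3) lda_pmf_eq_moments_agree[OF assms(1) G(1,2) assms(2,3) eq]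
    by (intro assms(4)) (auto simp: topic_mixtures_def)
qed

lemma min_len_over_le: "identifiable_upto a K G0 N \<Longrightarrow> 1 \<le> N \<Longrightarrow> min_len_over a G0 K \<le> enat N"
  unfolding min_len_over_def by (rule INF_lower) simp

lemma min_len_exact_eq_over: "min_len_exact a G0 = min_len_over a G0 (card (set_pmf G0))"
  by (simp add: min_len_exact_def min_len_over_def)

text \<open>Two distinct probability vectors are never proportional, so the Kruskal rank of at least two of them is at
  least two.\<close>

lemma kruskal_rank_props:
  fixes S :: "(real ^ 'v) set"
  assumes "S \<subseteq> prob_simplex" "2 \<le> card S"
  shows "2 \<le> kruskal_rank S" "kruskal_rank S \<le> card S"
    "\<And>T. T \<subseteq> S \<Longrightarrow> card T = kruskal_rank S \<Longrightarrow> independent T"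
proof -
  let ?M = "{r. r \<le> card S \<and> (\<forall>T\<subseteq>S. card T = r \<longrightarrow> independent T)}"
  have fin: "finite ?M" by simp
  have "independent T" if T: "T \<subseteq> S" "card T = 2" for T
  proof -
    obtain x y where xy: "T = {x, y}" "x \<noteq> y"
      using T(2) by (auto simp: card_2_iff)
    then have mem: "x \<in> prob_simplex" "y \<in> prob_simplex" using T(1) assms(1) by auto
    then have "x \<notin> span {y}" "y \<noteq> 0"
      using simplex_in_span_singleton xy(2) zero_notin_simplex by auto
    then show ?thesis
      using xy by (simp add: independent_insert)
  qed
  then have two: "2 \<in> ?M" using assms(2) by simp
  then show "2 \<le> kruskal_rank S"
    unfolding kruskal_rank_def by (rule Max_ge[OF fin])
  have "kruskal_rank S \<in> ?M"
    unfolding kruskal_rank_def using two by (intro Max_in[OF fin]) auto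
  then show "kruskal_rank S \<le> card S"
    "\<And>T. T \<subseteq> S \<Longrightarrow> card T = kruskal_rank S \<Longrightarrow> independent T" by auto
qed

lemma identifiable_general_position:
  fixes G0 :: "(real ^ 'v) pmf"
  assumes "a > 0" "finite (set_pmf G0)" "set_pmf G0 \<subseteq> prob_simplex"
    and "2 \<le> r" "r \<le> card (set_pmf G0)"
    and "\<And>T. T \<subseteq> set_pmf G0 \<Longrightarrow> card T = r \<Longrightarrow> independent T"
    and "2 * card (set_pmf G0) \<le> N * (r - 1) + 1"
  shows "identifiable_upto a (card (set_pmf G0)) G0 N"
proof (rule identifiable_uptoI[OF assms(1-3)])
  fix G :: "(real ^ 'v) pmf"
  assume "topic_mixtures G0 G" "card (set_pmf G) \<le> card (set_pmf G0)" "moments_agree N G G0"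
  then have "kruskal_mixtures G0 G N r"
    using assms by (simp add: kruskal_mixtures_def kruskal_mixtures_axioms_def)
  then show "G = G0"
    by (rule kruskal_mixtures.eq_if_general_position)
qed

theorem proposition3:
  fixes a :: real and G0 :: "(real ^ 'v) pmf" and K0 K :: nat
  assumes "a > 0" and "G0 \<in> mixing_exact K0" and "K > K0"
  shows
    "(min_len_exact a G0 \<le> enat (2 * K0 - 1) \<and> min_len_over a G0 K \<le> enat (2 * K0))
     \<and> (\<forall>R RK. dim (span (set_pmf G0)) = R \<and> kruskal_rank (set_pmf G0) = RK \<longrightarrow>
          (K0 \<ge> 2 \<longrightarrow> min_len_exact a G0 \<le> enat (nat \<lceil>(2 * real K0 - 1) / (real RK - 1)\<rceil>))
          \<and> min_len_over a G0 K \<le> enat (K + K0 + 3 - 2 * R))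
     \<and> (independent (set_pmf G0) \<longrightarrow>
          min_len_exact a G0 \<le> 3 \<and> min_len_over a G0 K \<le> 4)
     \<and> (anchor_word (set_pmf G0) \<longrightarrow>
          min_len_exact a G0 \<le> 2 \<and> min_len_over a G0 K \<le> 2)"
proof -
  let ?A = "set_pmf G0"
  have A: "finite ?A" "?A \<subseteq> prob_simplex" and card: "card ?A = K0"
    using assms(2) by (auto simp: mixing_exact_def)
  have K0: "1 \<le> K0"
    using A(1) card by (auto simp: Suc_le_eq card_gt_0_iff set_pmf_not_empty)
  note identI = identifiable_uptoI[OF assms(1) A]
  have exact: "min_len_exact a G0 \<le> enat (2 * K0 - 1)"
    unfolding min_len_exact_eq_over
  proof (rule min_len_over_le[OF identI])
    fix G assume "topic_mixtures G0 G" "card (set_pmf G) \<le> card ?A" "moments_agree (2 * K0 - 1) G G0"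
    then show "G = G0"
      using topic_mixtures.eq_if_exact_order[of G0 G] card by simp
  qed (use K0 in simp)
  have over: "min_len_over a G0 K \<le> enat (2 * K0)"
  proof (rule min_len_over_le[OF identI])
    fix G assume "topic_mixtures G0 G" "moments_agree (2 * K0) G G0"
    then show "G = G0"
      using topic_mixtures.eq_if_double_order[of G0 G] card by simp
  qed (use K0 in simp)
  have kruskal: "min_len_exact a G0 \<le> enat (nat \<lceil>(2 * real K0 - 1) / (real (kruskal_rank ?A) - 1)\<rceil>)"
    if "2 \<le> K0"
  proof -
    let ?r = "kruskal_rank ?A"
    define N where "N = nat \<lceil>(2 * real K0 - 1) / (real ?r - 1)\<rceil>"
    note r = kruskal_rank_props[OF A(2)]
    have r2: "2 \<le> ?r" using r(1) that card by simp
    have "(2 * real K0 - 1) / (real ?r - 1) \<le> real N"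
      unfolding N_def by (rule real_nat_ceiling_ge)
    then have "2 * real K0 - 1 \<le> real N * (real ?r - 1)"
      using r2 by (simp add: divide_le_eq)
    also have "\<dots> = real (N * (?r - 1))"
      using r2 by (simp add: of_nat_diff)
    finally have "real (2 * K0) \<le> real (N * (?r - 1) + 1)"
      by simp
    then have N_ge: "2 * K0 \<le> N * (?r - 1) + 1"
      by (simp only: of_nat_le_iff)
    have "N \<noteq> 0"
    proof
      assume "N = 0"
      with N_ge that show False by simp
    qed
    then have "1 \<le> N" by simp
    moreover have "identifiable_upto a (card ?A) G0 N"
      using that card N_ge by (intro identifiable_general_position[OF assms(1) A r]) auto
    ultimately show ?thesis
      unfolding min_len_exact_eq_over N_def[symmetric] by (intro min_len_over_le)
  qed
  have rank: "min_len_over a G0 K \<le> enat (K + K0 + 3 - 2 * dim ?A)"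
  proof (rule min_len_over_le[OF identI])
    have "dim ?A \<le> K0"
      using dim_le_card'[OF A(1)] card by simp
    then have N: "2 \<le> K + K0 + 3 - 2 * dim ?A" "2 * dim ?A \<le> K + K0 + 3"
      using assms(3) by linarith+
    then show "1 \<le> K + K0 + 3 - 2 * dim ?A" by linarith
    fix G assume G: "topic_mixtures G0 G" "card (set_pmf G) \<le> K"
      "moments_agree (K + K0 + 3 - 2 * dim ?A) G G0"
    then show "G = G0"
      using topic_mixtures.eq_if_rank_order[OF G(1,3) N(1)] N(2) card by simp
  qed
  \<comment> \<open>Independent topics are in general position with \<open>r = K0\<close>, and \<open>2 * K0 - 1 \<le> 3 * (K0 - 1)\<close> if \<open>K0 \<ge> 2\<close>.\<close>
  have independent_exact: "min_len_exact a G0 \<le> 3" if ind: "independent ?A"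
  proof (cases "2 \<le> K0")
    case True
    have "identifiable_upto a (card ?A) G0 3"
      using True card ind independent_mono
      by (intro identifiable_general_position[OF assms(1) A, where r = K0]) auto
    then have "min_len_exact a G0 \<le> enat 3"
      unfolding min_len_exact_eq_over by (intro min_len_over_le) auto
    then show ?thesis by (simp add: numeral_eq_enat)
  next
    case False
    then have "enat (2 * K0 - 1) \<le> enat 3" by simp
    with exact have "min_len_exact a G0 \<le> enat 3" by (rule order_trans)
    then show ?thesis by (simp add: numeral_eq_enat)
  qed
  have independent_over: "min_len_over a G0 K \<le> 4" if ind: "independent ?A"
  proof -
    have "identifiable_upto a K G0 4"
      using topic_mixtures.eq_if_independent[OF _ _ ind] by (intro identI) blast
    then have "min_len_over a G0 K \<le> enat 4" by (intro min_len_over_le) auto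
    then show ?thesis by (simp add: numeral_eq_enat)
  qed
  have anchor: "min_len_over a G0 k \<le> 2" if anchor: "anchor_word ?A" for k
  proof -
    have "identifiable_upto a k G0 2"
      using topic_mixtures.eq_if_anchor_word[OF _ _ anchor] by (intro identI) blast
    then have "min_len_over a G0 k \<le> enat 2" by (intro min_len_over_le) auto
    then show ?thesis by (simp add: numeral_eq_enat)
  qed
  show ?thesis
    using exact over kruskal rank independent_exact independent_over anchor
    by (auto simp: min_len_exact_eq_over)
qed

end
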